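(* Consider the polynomial-filtered ADMM (PFAM) iteration described in the context for a semidefinite program, and suppose that Assumption P of the context holds. The convergence $$\|Z^k-T_{\mathrm{DRS}}(Z^k)\|_F=\mathcal{O}(1/\sqrt{k})$$ is achieved if $$d_k=\Omega\left(\frac{\log k}{\min\{l,1\}}\right).$$
   Context: Let $\mathcal{S}^n$ be the real symmetric $n\times n$ matrices with inner product $\langle A,B\rangle=\mathrm{Tr}(A^TB)$ and Frobenius norm $\|\cdot\|_F$. Consider the SDP $\min\{\langle C,X\rangle:\mathcal{A}X=b,\ X\succeq0\}$ with $\mathcal{A}$ a bounded linear operator on $\mathcal{S}^n$ with $\mathcal{A}\mathcal{A}^*$ invertible. Let $F(X)=1_{\{X\succeq0\}}(X)$ and $G(X)=1_{\{\mathcal{A}X=b\}}(X)+\langle C,X\rangle$, where $1_\Omega$ is the indicator function of $\Omega$ ($0$ on $\Omega$, $+\infty$ elsewhere). For $t>0$, $\mathrm{prox}_{t\varphi}(Y)=\arg\min_X\varphi(X)+\frac1{2t}\|X-Y\|_F^2$; in particular $\mathrm{prox}_{tF}=\mathcal{P}_+$, the projection onto the positive semidefinite cone. The Douglas–Rachford operator is $$T_{\mathrm{DRS}}=\mathrm{prox}_{tG}(2\,\mathrm{prox}_{tF}-I)-\mathrm{prox}_{tF}+I .$$ For a matrix $S$ with orthonormal columns, $\mathcal{P}_S(X)=SS^TXSS^T$. PFAM. $$Z^{k+1}=\mathrm{prox}_{tG}\big(2\mathcal{P}_+(\mathcal{P}_{U^k}(Z^k))-Z^k\big)-\mathcal{P}_+(\mathcal{P}_{U^k}(Z^k))+Z^k,\qquad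 U^{k+1}=\mathrm{orth}\big(\rho_{k+1}^{q_{k+1}}(Z^{k+1})U^k\big),$$ where $U^k\in\mathbb{R}^{n\times p}$ has orthonormal columns, $p\ge|\mathcal{I}_k|$ ($\mathcal{I}_k$ below), $\mathrm{orth}$ denotes orthogonalization of the columns, $q_k\ge1$ is a small integer, and $\rho_k(s)=T_{d_k}\big(\frac{s-(b_k+a_k)/2}{(b_k-a_k)/2}\big)$ with $T_d$ the Chebyshev polynomial of the first kind of degree $d$ and $[a_k,b_k]$ the interval suppressed at iteration $k$; $d_k$ is the degree of the filter at iteration $k$. Let $V^k_{\mathcal{I}_k}$ be a matrix with orthonormal columns which are the eigenvectors of $Z^k$ corresponding to all its positive eigenvalues, indexed by $\mathcal{I}_k$; $\mathcal{I}_k$ is the index set of the eigenvalues $\lambda_i$ of $Z^k$ outside $[a_k,b_k]$. The relative gap is $$\mathcal{G}_k=\min_{i\in\mathcal{I}_k}\Big(\frac{|\lambda_i-(a_k+b_k)/2|}{(b_k-a_k)/2}-1\Big).$$ For matrices $X,Y$ with orthonormal columns, $\Theta(X,Y)$ is the diagonal matrix with diagonal entries $\arccos\sigma_j$, where $\sigma_1\ge\sigma_2\ge\cdots$ are the singular values of $X^TY$ (if the numbers of columns differ, as many singular values as the smaller number); $\sin\Theta$ is taken componentwise. Assumption P. (i) $\|\sin\Theta(V^{k+1}_{\mathcal{I}_{k+1}},U^k)\|_2<\gamma$ for all $k$, with $\gamma<1$. (ii) $\|Z^k\|_F\le M$ for all $k$, for some constant $M$. (iii) $\mathcal{G}_k\ge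 l$ for all $k$, with $l>0$. *)

theory Defs
  imports
    "HOL-Analysis.Analysis"
    "HOL-Computational_Algebra.Polynomial"
    "HOL-Library.Landau_Symbols"
begin

text \<open>
  Matrices are \<^typ>\<open>real^'c^'r\<close> ('r rows, 'c columns). On this type the library's inner product
  is the sum of the products of corresponding entries, i.e. the trace of X^T Y, and the library's
  \<^const>\<open>norm\<close> is therefore the Frobenius norm.
\<close>

section \<open>The semidefinite program and the Douglas--Rachford operator\<close>

definition sym_mats :: "(real^'n^'n) set" where
  "sym_mats = {X. transpose X = X}"

definition psd_cone :: "(real^'n^'n) set" where
  "psd_cone = {X \<in> sym_mats. \<forall>x. 0 \<le> x \<bullet> (X *v x)}"

text \<open>
  A is a linear operator on the space of symmetric matrices; its values at other matrices are
  irrelevant everywhere below. Boundedness is automatic in finite dimension.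
\<close>

definition linear_on_sym :: "(real^'n^'n \<Rightarrow> real^'m) \<Rightarrow> bool" where
  "linear_on_sym A \<longleftrightarrow>
     (\<forall>X\<in>sym_mats. \<forall>Y\<in>sym_mats. A (X + Y) = A X + A Y) \<and>
     (\<forall>X\<in>sym_mats. \<forall>r. A (r *\<^sub>R X) = r *\<^sub>R A X)"

text \<open>
  The adjoint is taken with respect to the space of symmetric matrices (not all square matrices),
  so that it takes symmetric values.
\<close>

definition adjoint_on_sym :: "(real^'n^'n \<Rightarrow> real^'m) \<Rightarrow> (real^'m \<Rightarrow> real^'n^'n) \<Rightarrow> bool" where
  "adjoint_on_sym A As \<longleftrightarrow>
     (\<forall>y. As y \<in> sym_mats \<and> (\<forall>X\<in>sym_mats. A X \<bullet> y = X \<bullet> As y))"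

definition sdp_data :: "real^'n^'n \<Rightarrow> (real^'n^'n \<Rightarrow> real^'m) \<Rightarrow> bool" where
  "sdp_data C A \<longleftrightarrow> C \<in> sym_mats \<and> linear_on_sym A \<and>
     (\<exists>As. adjoint_on_sym A As \<and> bij (A \<circ> As))"

definition indicator_fun :: "'a set \<Rightarrow> 'a \<Rightarrow> ereal" where
  "indicator_fun S x = (if x \<in> S then 0 else \<infinity>)"

definition F :: "real^'n^'n \<Rightarrow> ereal" where
  "F X = indicator_fun psd_cone X"

definition G :: "real^'n^'n \<Rightarrow> (real^'n^'n \<Rightarrow> real^'m) \<Rightarrow> real^'m \<Rightarrow> real^'n^'n \<Rightarrow> ereal" where
  "G C A b X = indicator_fun {X. A X = b} X + ereal (C \<bullet> X)"

definition prox :: "real \<Rightarrow> (real^'n^'n \<Rightarrow> ereal) \<Rightarrow> real^'n^'n \<Rightarrow> real^'n^'n" where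
  "prox t \<phi> Y = arg_min_on (\<lambda>X. \<phi> X + ereal (1 / (2 * t) * (norm (X - Y))\<^sup>2)) sym_mats"

definition T_DRS ::
  "real^'n^'n \<Rightarrow> (real^'n^'n \<Rightarrow> real^'m) \<Rightarrow> real^'m \<Rightarrow> real \<Rightarrow> real^'n^'n \<Rightarrow> real^'n^'n" where
  "T_DRS C A b t Z = prox t (G C A b) (2 *\<^sub>R prox t F Z - Z) - prox t F Z + Z"

section \<open>The polynomial-filtered iteration\<close>

definition proj_psd :: "real^'n^'n \<Rightarrow> real^'n^'n" where
  "proj_psd X = closest_point psd_cone X"

definition orthonormal_cols :: "real^'p^'n \<Rightarrow> bool" where
  "orthonormal_cols S \<longleftrightarrow> transpose S ** S = mat 1"

definition proj_sub :: "real^'p^'n \<Rightarrow> real^'n^'n \<Rightarrow> real^'n^'n" where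
  "proj_sub S X = S ** transpose S ** X ** S ** transpose S"

text \<open>
  Q is an orthogonalization of the columns of M. When M has full column rank, the two column spaces
  coincide. When it does not (an eigenvalue may be a zero of the filter), Q still has as many columns
  as M, as for the factor Q of a QR factorization, so its column space can only contain that of M.
\<close>

definition is_orth :: "real^'p^'n \<Rightarrow> real^'p^'n \<Rightarrow> bool" where
  "is_orth M Q \<longleftrightarrow> orthonormal_cols Q \<and> span (columns M) \<subseteq> span (columns Q)"

fun chebyshev :: "nat \<Rightarrow> real poly" where
  "chebyshev 0 = 1"
| "chebyshev (Suc 0) = [:0, 1:]"
| "chebyshev (Suc (Suc d)) = [:0, 2:] * chebyshev (Suc d) - chebyshev d"

definition filter_poly :: "nat \<Rightarrow> real \<Rightarrow> real \<Rightarrow> real poly" where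
  "filter_poly d lo hi =
     pcompose (chebyshev d) [: - ((hi + lo) / 2) / ((hi - lo) / 2), 1 / ((hi - lo) / 2) :]"

lemma poly_filter_poly:
  "poly (filter_poly d lo hi) s = poly (chebyshev d) ((s - (hi + lo) / 2) / ((hi - lo) / 2))"
  by (simp add: filter_poly_def poly_pcompose diff_divide_distrib)

primrec mat_pow :: "real^'n^'n \<Rightarrow> nat \<Rightarrow> real^'n^'n" where
  "mat_pow X 0 = mat 1"
| "mat_pow X (Suc i) = X ** mat_pow X i"

definition poly_mat :: "real poly \<Rightarrow> real^'n^'n \<Rightarrow> real^'n^'n" where
  "poly_mat r X = (\<Sum>i\<le>degree r. coeff r i *\<^sub>R mat_pow X i)"

text \<open>The interval suppressed at iteration k is [lo k, hi k].\<close>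

definition pfam ::
  "real^'n^'n \<Rightarrow> (real^'n^'n \<Rightarrow> real^'m) \<Rightarrow> real^'m \<Rightarrow> real \<Rightarrow>
   (nat \<Rightarrow> real) \<Rightarrow> (nat \<Rightarrow> real) \<Rightarrow> (nat \<Rightarrow> nat) \<Rightarrow> (nat \<Rightarrow> nat) \<Rightarrow>
   (nat \<Rightarrow> real^'n^'n) \<Rightarrow> (nat \<Rightarrow> real^'p^'n) \<Rightarrow> bool" where
  "pfam C A b t lo hi d q Z U \<longleftrightarrow>
     Z 0 \<in> sym_mats \<and> orthonormal_cols (U 0) \<and> (\<forall>k. lo k < hi k \<and> 1 \<le> q k) \<and>
     (\<forall>k. Z (Suc k) =
        (let P = proj_psd (proj_sub (U k) (Z k))
         in prox t (G C A b) (2 *\<^sub>R P - Z k) - P + Z k)) \<and>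
     (\<forall>k. is_orth
        (poly_mat (filter_poly (d (Suc k)) (lo (Suc k)) (hi (Suc k)) ^ q (Suc k)) (Z (Suc k)) ** U k)
        (U (Suc k)))"

section \<open>Spectral data, relative gap and principal angles\<close>

text \<open>
  The columns of the orthogonal matrix V are eigenvectors, and the entries of lam the corresponding
  eigenvalues counted with multiplicity.
\<close>

definition eigen_decomp :: "real^'n^'n \<Rightarrow> real^'n^'n \<Rightarrow> real^'n \<Rightarrow> bool" where
  "eigen_decomp X V lam \<longleftrightarrow>
     orthogonal_matrix V \<and> (\<forall>i. X *v column i V = lam $ i *\<^sub>R column i V)"

definition outside :: "real^'n \<Rightarrow> real \<Rightarrow> real \<Rightarrow> 'n set" where
  "outside lam lo hi = {i. lam $ i \<notin> {lo..hi}}"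

text \<open>
  The infimum over a finite set is a minimum. It is taken in \<^typ>\<open>ereal\<close> so that the gap is infinite
  when no eigenvalue lies outside the interval.
\<close>

definition rel_gap :: "real^'n \<Rightarrow> real \<Rightarrow> real \<Rightarrow> ereal" where
  "rel_gap lam lo hi =
     (INF i\<in>outside lam lo hi. ereal (\<bar>lam $ i - (lo + hi) / 2\<bar> / ((hi - lo) / 2) - 1))"

text \<open>
  The number of columns of the matrix of selected eigenvectors varies with the iteration, so the
  matrices X^T Y and \<open>\<Theta>\<close>(X,Y) are functions of two indices, restricted to finite index sets. The
  following predicate says that M, with rows I and columns J, has a singular value decomposition
  with left singular vectors u l, right singular vectors w l and singular values sv.
\<close>

definition is_singular_values ::
  "'i set \<Rightarrow> 'j set \<Rightarrow> ('i \<Rightarrow> 'j \<Rightarrow> real) \<Rightarrow> real list \<Rightarrow> bool" where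
  "is_singular_values I J M sv \<longleftrightarrow>
     length sv = min (card I) (card J) \<and> sorted_wrt (\<ge>) sv \<and> (\<forall>s\<in>set sv. 0 \<le> s) \<and>
     (\<exists>u w. (\<forall>l<length sv. \<forall>m<length sv.
                (\<Sum>i\<in>I. u l i * u m i) = (if l = m then 1 else 0) \<and>
                (\<Sum>j\<in>J. w l j * w m j) = (if l = m then 1 else 0)) \<and>
            (\<forall>i\<in>I. \<forall>j\<in>J. M i j = (\<Sum>l<length sv. sv ! l * u l i * w l j)))"

definition angle_matrix :: "real list \<Rightarrow> nat \<Rightarrow> nat \<Rightarrow> real" where
  "angle_matrix sv l m = (if l = m then arccos (sv ! l) else 0)"

definition spectral_norm :: "'i set \<Rightarrow> 'j set \<Rightarrow> ('i \<Rightarrow> 'j \<Rightarrow> real) \<Rightarrow> real" where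
  "spectral_norm I J M =
     (SUP x\<in>{x. L2_set x J \<le> 1}. L2_set (\<lambda>i. \<Sum>j\<in>J. M i j * x j) I)"

text \<open>
  The spectral norm of sin \<open>\<Theta>\<close>(V_I, U) is less than g, where V_I consists of the columns of V with
  index in I. Singular values always exist and are unique, so the quantifier only names them.
\<close>

definition sin_Theta_less :: "'n set \<Rightarrow> real^'n^'n \<Rightarrow> real^'p^'n \<Rightarrow> real \<Rightarrow> bool" where
  "sin_Theta_less I V U g \<longleftrightarrow>
     (\<exists>sv. is_singular_values I UNIV (\<lambda>i j. column i V \<bullet> column j U) sv \<and>
           spectral_norm {..<length sv} {..<length sv} (\<lambda>l m. sin (angle_matrix sv l m)) < g)"

text \<open>
  The index set of the eigenvalues outside the suppressed interval is at the same time the index set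
  of the positive eigenvalues, and it has at most as many elements as the U k have columns.
\<close>

definition filter_spectrum ::
  "(nat \<Rightarrow> real) \<Rightarrow> (nat \<Rightarrow> real) \<Rightarrow> (nat \<Rightarrow> real^'n^'n) \<Rightarrow> (nat \<Rightarrow> real^'p^'n) \<Rightarrow>
   (nat \<Rightarrow> real^'n^'n) \<Rightarrow> (nat \<Rightarrow> real^'n) \<Rightarrow> bool" where
  "filter_spectrum lo hi Z U V lam \<longleftrightarrow>
     (\<forall>k. eigen_decomp (Z k) (V k) (lam k) \<and>
          outside (lam k) (lo k) (hi k) = {i. 0 < lam k $ i} \<and>
          card (outside (lam k) (lo k) (hi k)) \<le> CARD('p))"

definition assumption_P ::
  "(nat \<Rightarrow> real) \<Rightarrow> (nat \<Rightarrow> real) \<Rightarrow> (nat \<Rightarrow> real^'n^'n) \<Rightarrow> (nat \<Rightarrow> real^'p^'n) \<Rightarrow>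
   (nat \<Rightarrow> real^'n^'n) \<Rightarrow> (nat \<Rightarrow> real^'n) \<Rightarrow> real \<Rightarrow> real \<Rightarrow> real \<Rightarrow> bool" where
  "assumption_P lo hi Z U V lam \<gamma> M l \<longleftrightarrow>
     \<gamma> < 1 \<and>
     (\<forall>k. sin_Theta_less (outside (lam (Suc k)) (lo (Suc k)) (hi (Suc k))) (V (Suc k)) (U k) \<gamma>) \<and>
     (\<forall>k. norm (Z k) \<le> M) \<and>
     0 < l \<and> (\<forall>k. ereal l \<le> rel_gap (lam k) (lo k) (hi k))"

end

theory Submission
  imports Defs
begin

text \<open>
  The Douglas--Rachford operator T is firmly nonexpansive and PFAM is an orbit of T with an error in
  each step. If the errors are O(1/k^2) and the orbit is bounded, T has a fixed point, the squares of
  the residuals |Z k - T (Z k)| are summable, and up to the tail of the errors the residuals decrease;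
  hence they are O(1 / sqrt k).

  For the error bound, the angle condition provides for each positive eigenvalue of Z k a vector in the
  range of the previous U whose components along the wanted eigenvectors are those of the corresponding
  unit eigenvector and whose norm is at most 1 / sqrt (1 - \<open>\<gamma>\<close>^2). The filter is at most 1 in absolute
  value on the suppressed interval and at least (1 + min l 1)^d on the wanted eigenvalues, so the
  eigenvector has distance O((1 + min l 1)^(-d)) from the range of the new U, and this is O(1/k^2) when
  d is at least 4 log k / min l 1.
\<close>

section \<open>Inexact orbits of firmly nonexpansive maps\<close>

lemma sum_inverse_squares_le: "(\<Sum>k<n. 1 / (real (Suc k))\<^sup>2) \<le> 2"
proof -
  \<comment> \<open>The claim is strengthened by \<open>- 1 / real (Suc n)\<close> so that the
    induction closes: the next term is at most the difference of two consecutive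
    reciprocals.\<close>
  have "(\<Sum>k<Suc n. 1 / (real (Suc k))\<^sup>2) \<le> 2 - 1 / real (Suc n)" for n
  proof (induction n)
    case (Suc n)
    have "1 / ((x + 1) * (x + 1)) + 1 / (x + 1) \<le> 1 / x" if "x \<ge> 1" for x :: real
      using that by (simp add: divide_simps) (simp add: algebra_simps)
    from this[of "real (Suc n)"] Suc show ?case
      by (simp add: power2_eq_square algebra_simps)
  qed simp
  from order_trans[OF this[of "n - 1"], of 2] show ?thesis by (cases n) auto
qed

lemma firm_imp_nonexpansive:
  fixes T :: "'a::real_inner \<Rightarrow> 'a"
  assumes "\<And>x y. (norm (T x - T y))\<^sup>2 + (norm ((x - T x) - (y - T y)))\<^sup>2 \<le> (norm (x - y))\<^sup>2"
  shows "norm (T x - T y) \<le> norm (x - y)"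
proof (rule power2_le_imp_le)
  show "(norm (T x - T y))\<^sup>2 \<le> (norm (x - y))\<^sup>2"
    using assms[of x y] zero_le_power2[of "norm ((x - T x) - (y - T y))"] by linarith
qed simp

text \<open>The fixed point is a cluster point of the Cesaro means of the orbit.\<close>

lemma inexact_orbit_fixed_point:
  fixes T :: "'a::euclidean_space \<Rightarrow> 'a" and Z :: "nat \<Rightarrow> 'a"
  assumes ne: "\<And>x y. norm (T x - T y) \<le> norm (x - y)"
    and bnd: "\<And>k. norm (Z k) \<le> M"
    and err: "\<And>k. norm (Z (Suc k) - T (Z k)) \<le> E k"
    and E: "\<And>k. E k \<le> B" "\<And>n. (\<Sum>k<n. E k) \<le> S"
  obtains p where "T p = p"
proof -
  define c where "c n = (1 / real (Suc n)) *\<^sub>R (\<Sum>k<Suc n. Z k)" for n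
  have "norm (c n) \<le> M" for n
  proof -
    have "norm (\<Sum>k<Suc n. Z k) \<le> (\<Sum>k<Suc n. M)"
      using bnd by (intro sum_norm_le) auto
    then show ?thesis by (simp add: c_def divide_simps mult.commute del: sum.lessThan_Suc)
  qed
  then have "\<forall>n. c n \<in> cball 0 M" by simp
  then obtain p \<phi> where \<phi>: "strict_mono \<phi>" and lim: "(c \<circ> \<phi>) \<longlonglongrightarrow> p"
    using compact_cball[of "0::'a" M] unfolding compact_def by metis
  define R where "R = M + norm p"
  define K where "K = (norm (Z 0 - T p))\<^sup>2 + (2 * R + B) * S"
  have E0: "0 \<le> E k" for k
    using order_trans[OF norm_ge_zero err[of k]] .
  have "0 \<le> B" using E0[of 0] E(1)[of 0] by linarith
  have "0 \<le> R" using bnd[of 0] norm_ge_zero[of "Z 0"] norm_ge_zero[of p] unfolding R_def by linarith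
  \<comment> \<open>Distances are measured to \<open>T p\<close>, so that nonexpansiveness applies
    to the pair \<open>Z k\<close>, \<open>p\<close>. Expanding the squared distance from
    \<open>Z k\<close> to \<open>p\<close> about \<open>T p\<close> leaves, besides a constant, only
    a term affine in \<open>Z k\<close>, and this survives averaging.\<close>
  have step: "(norm (Z (Suc k) - T p))\<^sup>2 - (norm (Z k - T p))\<^sup>2
      \<le> 2 * ((Z k - T p) \<bullet> (T p - p)) + (norm (T p - p))\<^sup>2 + (2 * R + B) * E k" for k
  proof -
    have R: "norm (Z k - p) \<le> R"
      using norm_triangle_ineq4[of "Z k" p] bnd[of k] by (simp add: R_def)
    have "norm (Z (Suc k) - T p) \<le> norm (T (Z k) - T p) + norm (Z (Suc k) - T (Z k))"
      using norm_triangle_ineq[of "T (Z k) - T p" "Z (Suc k) - T (Z k)"] by simp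
    also have "\<dots> \<le> norm (Z k - p) + E k"
      using ne err by (intro add_mono) auto
    finally have "(norm (Z (Suc k) - T p))\<^sup>2 \<le> (norm (Z k - p) + E k)\<^sup>2"
      by (intro power_mono) auto
    also have "\<dots> = (norm (Z k - p))\<^sup>2 + (2 * norm (Z k - p) + E k) * E k"
      by (simp add: power2_eq_square algebra_simps)
    also have "(2 * norm (Z k - p) + E k) * E k \<le> (2 * R + B) * E k"
      using R E E0 by (intro mult_right_mono add_mono) auto
    finally have "(norm (Z (Suc k) - T p))\<^sup>2 \<le> (norm (Z k - p))\<^sup>2 + (2 * R + B) * E k"
      by simp
    moreover have "(norm (Z k - p))\<^sup>2 = (norm (Z k - T p))\<^sup>2
        + 2 * ((Z k - T p) \<bullet> (T p - p)) + (norm (T p - p))\<^sup>2"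
      by (simp add: power2_norm_eq_inner inner_simps inner_commute algebra_simps)
    ultimately show ?thesis by linarith
  qed
  \<comment> \<open>Telescoping over the first n + 1 steps and dividing by n + 1 replaces
    \<open>Z k\<close> by its mean \<open>c n\<close>; the initial distance and all errors end up in
    \<open>K / real (Suc n)\<close>.\<close>
  have est: "0 \<le> K / real (Suc n) + 2 * ((c n - T p) \<bullet> (T p - p)) + (norm (T p - p))\<^sup>2" for n
  proof -
    have "(\<Sum>k<Suc n. (norm (Z (Suc k) - T p))\<^sup>2 - (norm (Z k - T p))\<^sup>2)
        = (norm (Z (Suc n) - T p))\<^sup>2 - (norm (Z 0 - T p))\<^sup>2"
      by (rule sum_lessThan_telescope)
    then have "- (norm (Z 0 - T p))\<^sup>2 \<le> (\<Sum>k<Suc n. (norm (Z (Suc k) - T p))\<^sup>2 - (norm (Z k - T p))\<^sup>2)"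
      by (simp del: sum.lessThan_Suc)
    also have "\<dots> \<le> (\<Sum>k<Suc n. 2 * ((Z k - T p) \<bullet> (T p - p)) + (norm (T p - p))\<^sup>2 + (2 * R + B) * E k)"
      by (intro sum_mono step)
    also have "\<dots> = 2 * ((\<Sum>k<Suc n. Z k - T p) \<bullet> (T p - p)) + real (Suc n) * (norm (T p - p))\<^sup>2
        + (2 * R + B) * (\<Sum>k<Suc n. E k)"
      unfolding sum.distrib sum_distrib_left[symmetric] inner_sum_left[symmetric] by simp
    also have "(\<Sum>k<Suc n. Z k - T p) = real (Suc n) *\<^sub>R (c n - T p)"
      unfolding sum_subtractf c_def by (simp add: sum_constant_scaleR scaleR_right_diff_distrib del: sum.lessThan_Suc)
    also have "(2 * R + B) * (\<Sum>k<Suc n. E k) \<le> (2 * R + B) * S"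
      using \<open>0 \<le> R\<close> \<open>0 \<le> B\<close> by (intro mult_left_mono E(2)) auto
    finally have "0 \<le> K + real (Suc n) * (2 * ((c n - T p) \<bullet> (T p - p)) + (norm (T p - p))\<^sup>2)"
      by (simp add: K_def algebra_simps)
    then have "0 \<le> (K + real (Suc n) * (2 * ((c n - T p) \<bullet> (T p - p)) + (norm (T p - p))\<^sup>2)) / real (Suc n)"
      by simp
    then show ?thesis by (simp add: add_divide_distrib)
  qed
  \<comment> \<open>Along \<open>\<phi>\<close> the means tend to \<open>p\<close>, where the linear
    term is -2 times the squared norm of \<open>T p - p\<close>. The limit of \<open>est\<close>
    therefore says that minus this squared norm is nonnegative.\<close>
  have "((\<lambda>n. K / real (Suc n) + 2 * ((c n - T p) \<bullet> (T p - p)) + (norm (T p - p))\<^sup>2) \<circ> \<phi>)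
      \<longlonglongrightarrow> (0 + 2 * ((p - T p) \<bullet> (T p - p)) + (norm (T p - p))\<^sup>2)"
  proof -
    have "(\<lambda>n. K / real (Suc n)) \<longlonglongrightarrow> 0"
      by (rule LIMSEQ_Suc) (rule lim_const_over_n)
    from LIMSEQ_subseq_LIMSEQ[OF this \<phi>] show ?thesis
      using lim unfolding o_def by (intro tendsto_intros)
  qed
  then have "0 \<le> 0 + 2 * ((p - T p) \<bullet> (T p - p)) + (norm (T p - p))\<^sup>2"
    by (rule LIMSEQ_le_const) (use est in auto)
  also have "\<dots> = - (norm (T p - p))\<^sup>2"
    by (simp add: power2_norm_eq_inner inner_simps inner_commute)
  finally have "T p = p" by simp
  then show thesis by (rule that)
qed

text \<open>Firmness at a fixed point bounds the sums of the squared residuals. For a nonincreasing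
  nonnegative sequence, n times the n-th square is at most the sum of the n squares before it, which
  gives the rate once the residuals have been made monotone.\<close>

lemma inexact_firm_rate:
  fixes T :: "'a::euclidean_space \<Rightarrow> 'a" and Z :: "nat \<Rightarrow> 'a"
  assumes firm: "\<And>x y. (norm (T x - T y))\<^sup>2 + (norm ((x - T x) - (y - T y)))\<^sup>2 \<le> (norm (x - y))\<^sup>2"
    and bnd: "\<And>k. norm (Z k) \<le> M"
    and err: "\<And>k. norm (Z (Suc k) - T (Z k)) \<le> B / (real (Suc k))\<^sup>2"
  shows "(\<lambda>k. norm (Z k - T (Z k))) \<in> O(\<lambda>k. 1 / sqrt (real k))"
proof -
  define E where "E k = B / (real (Suc k))\<^sup>2" for k
  have ne: "norm (T x - T y) \<le> norm (x - y)" for x y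
    by (rule firm_imp_nonexpansive) (rule firm)
  have B: "0 \<le> B"
    using order_trans[OF norm_ge_zero err[of 0]] by simp
  have EB: "E k \<le> B" and E0: "0 \<le> E k" for k
    using B by (auto simp: E_def divide_simps mult_le_cancel_left1)
  have ES: "(\<Sum>k<n. E k) \<le> B * 2" for n
    using mult_left_mono[OF sum_inverse_squares_le B] by (simp add: E_def sum_distrib_left)
  obtain p where p: "T p = p"
    using inexact_orbit_fixed_point[OF ne bnd err[folded E_def] EB ES] .
  define R where "R = M + norm p"
  define r where "r k = norm (Z k - T (Z k))" for k
  have R0: "0 \<le> R" using bnd[of 0] norm_ge_zero[of "Z 0"] norm_ge_zero[of p] unfolding R_def by linarith
  \<comment> \<open>Firmness for the pair \<open>Z k\<close>, \<open>p\<close> bounds the squared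
    residual by the drop in squared distance to \<open>p\<close> under an exact step; the inexact
    step changes this by at most a multiple of \<open>E k\<close>.\<close>
  have r2: "(r k)\<^sup>2 \<le> (norm (Z k - p))\<^sup>2 - (norm (Z (Suc k) - p))\<^sup>2 + (2 * R + B) * E k" for k
  proof -
    have f: "(norm (T (Z k) - p))\<^sup>2 + (r k)\<^sup>2 \<le> (norm (Z k - p))\<^sup>2"
      using firm[of "Z k" p] by (simp add: p r_def)
    have R: "norm (T (Z k) - p) \<le> R"
      using ne[of "Z k" p] norm_triangle_ineq4[of "Z k" p] bnd[of k] by (simp add: R_def p)
    have "norm (Z (Suc k) - p) \<le> norm (T (Z k) - p) + E k"
      using norm_triangle_ineq[of "T (Z k) - p" "Z (Suc k) - T (Z k)"] err[of k] by (simp add: E_def)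
    then have "(norm (Z (Suc k) - p))\<^sup>2 \<le> (norm (T (Z k) - p) + E k)\<^sup>2"
      by (intro power_mono) auto
    also have "\<dots> = (norm (T (Z k) - p))\<^sup>2 + (2 * norm (T (Z k) - p) + E k) * E k"
      by (simp add: power2_eq_square algebra_simps)
    also have "(2 * norm (T (Z k) - p) + E k) * E k \<le> (2 * R + B) * E k"
      using R EB E0 by (intro mult_right_mono add_mono) auto
    finally show ?thesis using f by linarith
  qed
  define A where "A = R\<^sup>2 + (2 * R + B) * (B * 2)"
  have r2sum: "(\<Sum>k<n. (r k)\<^sup>2) \<le> A" for n
  proof -
    have "(\<Sum>k<n. (r k)\<^sup>2) \<le> (\<Sum>k<n. (norm (Z k - p))\<^sup>2 - (norm (Z (Suc k) - p))\<^sup>2 + (2 * R + B) * E k)"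
      by (intro sum_mono r2)
    also have "\<dots> = (norm (Z 0 - p))\<^sup>2 - (norm (Z n - p))\<^sup>2 + (2 * R + B) * (\<Sum>k<n. E k)"
      using sum_lessThan_telescope'[of "\<lambda>k. (norm (Z k - p))\<^sup>2" n]
      by (simp add: sum.distrib sum_distrib_left)
    also have "\<dots> \<le> R\<^sup>2 - 0 + (2 * R + B) * (B * 2)"
    proof (intro add_mono diff_mono mult_left_mono power_mono ES)
      show "norm (Z 0 - p) \<le> R"
        using norm_triangle_ineq4[of "Z 0" p] bnd[of 0] by (simp add: R_def)
    qed (use R0 B in auto)
    finally show ?thesis by (simp add: A_def)
  qed
  \<comment> \<open>The added term absorbs the errors and makes the residuals monotone.\<close>
  define s where "s k = r k + 4 * B / real (Suc k)" for k
  have "s (Suc k) \<le> s k" for k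
  proof -
    have "norm (Z (Suc k) - T (Z (Suc k))) \<le> norm (Z (Suc k) - T (Z k)) + norm (T (Z k) - T (Z (Suc k)))"
      using norm_triangle_ineq[of "Z (Suc k) - T (Z k)" "T (Z k) - T (Z (Suc k))"] by simp
    moreover have "norm (T (Z k) - T (Z (Suc k))) \<le> norm (Z k - Z (Suc k))"
      by (rule ne)
    moreover have "norm (Z k - Z (Suc k)) \<le> r k + norm (Z (Suc k) - T (Z k))"
      using norm_triangle_ineq4[of "Z k - T (Z k)" "Z (Suc k) - T (Z k)"] by (simp add: r_def)
    ultimately have "r (Suc k) \<le> r k + 2 * E k"
      using err[of k] unfolding r_def E_def by linarith
    \<comment> \<open>The correction drops by 4 B / ((k + 1) (k + 2)), which is at least 2 B / (k +
      1)^2 because k + 2 \<le> 2 (k + 1).\<close>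
    moreover have "2 * E k + 4 * B / real (Suc (Suc k)) \<le> 4 * B / real (Suc k)"
    proof -
      have "2 / (x * x) + 4 / (x + 1) \<le> 4 / x" if "x \<ge> 1" for x :: real
        using that by (simp add: divide_simps) (simp add: algebra_simps)
      from mult_left_mono[OF this[of "real (Suc k)"] B] show ?thesis
        by (simp add: E_def power2_eq_square algebra_simps add_divide_distrib)
    qed
    ultimately show ?thesis unfolding s_def by linarith
  qed
  then have mono: "s n \<le> s k" if "k \<le> n" for k n
    using that by (rule lift_Suc_antimono_le)
  have s0: "0 \<le> s k" for k using B by (simp add: s_def r_def)
  \<comment> \<open>The factor 32 is 2 times 4^2, from (x + y)^2 \<le> 2 x^2 + 2 y^2 applied to the
    correction term; the last 2 bounds the sum of the inverse squares.\<close>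
  define D where "D = 2 * A + 32 * B\<^sup>2 * 2"
  have bound: "real n * (s n)\<^sup>2 \<le> D" for n
  proof -
    have "real n * (s n)\<^sup>2 = (\<Sum>k<n. (s n)\<^sup>2)" by simp
    also have "\<dots> \<le> (\<Sum>k<n. (s k)\<^sup>2)"
      using mono s0 by (intro sum_mono power_mono) auto
    also have "\<dots> \<le> (\<Sum>k<n. 2 * (r k)\<^sup>2 + 32 * B\<^sup>2 * (1 / (real (Suc k))\<^sup>2))"
    proof (intro sum_mono)
      fix k
      have "(x + y)\<^sup>2 \<le> 2 * x\<^sup>2 + 2 * y\<^sup>2" for x y :: real
        using sum_squares_bound[of x y] by (simp add: power2_sum)
      from this[of "r k" "4 * B / real (Suc k)"]
      show "(s k)\<^sup>2 \<le> 2 * (r k)\<^sup>2 + 32 * B\<^sup>2 * (1 / (real (Suc k))\<^sup>2)"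
        by (simp add: s_def power_divide power_mult_distrib)
    qed
    also have "\<dots> = 2 * (\<Sum>k<n. (r k)\<^sup>2) + 32 * B\<^sup>2 * (\<Sum>k<n. 1 / (real (Suc k))\<^sup>2)"
      by (simp only: sum.distrib sum_distrib_left)
    also have "\<dots> \<le> D"
      unfolding D_def using r2sum sum_inverse_squares_le by (intro add_mono mult_left_mono) auto
    finally show ?thesis .
  qed
  have "norm (r k) \<le> sqrt D * norm (1 / sqrt (real k))" if "k \<ge> 1" for k
  proof -
    have "r k \<le> s k" using B by (simp add: s_def)
    also have "s k = sqrt (real k * (s k)\<^sup>2) / sqrt (real k)"
      using s0[of k] that by (simp add: real_sqrt_mult)
    also have "\<dots> \<le> sqrt D / sqrt (real k)"
      using bound[of k] by (intro divide_right_mono) auto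
    finally show ?thesis by (simp add: r_def)
  qed
  then have "r \<in> O(\<lambda>k. 1 / sqrt (real k))"
    by (intro bigoI[where c = "sqrt D"] eventually_sequentiallyI[of 1])
  then show ?thesis by (simp add: r_def[abs_def])
qed

section \<open>The proximal maps of the semidefinite program\<close>

text \<open>The sum of the variational inequalities at x and at y, each tested with the other
  projection.\<close>

lemma closest_point_firm:
  fixes S :: "'a::euclidean_space set"
  assumes "convex S" "closed S" "S \<noteq> {}"
  shows "(norm (closest_point S x - closest_point S y))\<^sup>2
    \<le> (closest_point S x - closest_point S y) \<bullet> (x - y)"
proof -
  have "(x - closest_point S x) \<bullet> (closest_point S y - closest_point S x) \<le> 0"
    "(y - closest_point S y) \<bullet> (closest_point S x - closest_point S y) \<le> 0"
    using assms by (auto intro!: closest_point_dot closest_point_in_set)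
  then show ?thesis
    by (simp add: power2_norm_eq_inner inner_simps inner_commute algebra_simps)
qed

text \<open>\<open>prox\<close> selects a minimizer by choice, so evaluating it requires that there
  is exactly one. Only the order of the values of f enters, which allows extended-real f: in the
  uses, S is the effective domain inside the ambient set R, and on S the values are ordered like the
  distances to w.\<close>

lemma arg_min_on_eq_closest_point:
  fixes S :: "'a::euclidean_space set" and f :: "'a \<Rightarrow> 'b::linorder"
  assumes S: "convex S" "closed S" "S \<noteq> {}" "S \<subseteq> R"
    and less: "\<And>x y. x \<in> S \<Longrightarrow> y \<in> S \<Longrightarrow> f x < f y \<longleftrightarrow> norm (x - w) < norm (y - w)"
    and outside: "\<And>x y. x \<in> S \<Longrightarrow> y \<in> R - S \<Longrightarrow> f x < f y"
  shows "arg_min_on f R = closest_point S w"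
proof -
  have "is_arg_min f (\<lambda>x. x \<in> R) x \<longleftrightarrow> x = closest_point S w" for x
  proof
    assume "is_arg_min f (\<lambda>x. x \<in> R) x"
    then have x: "x \<in> R" "\<And>y. y \<in> R \<Longrightarrow> \<not> f y < f x"
      by (auto simp: is_arg_min_def)
    obtain s where "s \<in> S" using S by auto
    then have "x \<in> S" using x S outside[of s x] by auto
    moreover have "\<forall>y\<in>S. dist w x \<le> dist w y"
      using x(2) less[OF _ \<open>x \<in> S\<close>] S(4) by (fastforce simp: dist_norm norm_minus_commute not_less)
    ultimately show "x = closest_point S w"
      using closest_point_unique[OF S(1,2)] by metis
  next
    assume x: "x = closest_point S w"
    have xS: "x \<in> S" using S x closest_point_in_set by auto
    have le: "norm (x - w) \<le> norm (y - w)" if "y \<in> S" for y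
      using closest_point_le[OF S(2) that, of w] by (simp add: x dist_norm norm_minus_commute)
    show "is_arg_min f (\<lambda>x. x \<in> R) x"
      unfolding is_arg_min_def
    proof (intro conjI notI)
      show "x \<in> R" using xS S by auto
      assume "\<exists>y. y \<in> R \<and> f y < f x"
      then obtain y where y: "y \<in> R" "f y < f x" by blast
      show False
      proof (cases "y \<in> S")
        case True
        then show ?thesis using less[OF True xS] le[OF True] y by simp
      next
        case False
        then show ?thesis using outside[OF xS, of y] y by auto
      qed
    qed
  qed
  then show ?thesis by (simp add: arg_min_on_def arg_min_def)
qed

section \<open>The semidefinite cone and the feasible set as targets of projections\<close>

lemma subspace_sym_mats: "subspace (sym_mats :: (real^'n^'n) set)"
  by (auto simp: subspace_def sym_mats_def transpose_def vec_eq_iff)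

lemma psd_cone_props:
  "convex (psd_cone :: (real^'n^'n) set)" "closed (psd_cone :: (real^'n^'n) set)" "0 \<in> (psd_cone :: (real^'n^'n) set)"
proof -
  have lin: "linear (\<lambda>X :: real^'n^'n. x \<bullet> (X *v x))" for x
    by (rule linearI) (simp_all add: matrix_vector_mult_add_rdistrib inner_simps scaleR_matrix_vector_assoc[symmetric])
  have eq: "psd_cone = sym_mats \<inter> (\<Inter>x. {X :: real^'n^'n. 0 \<le> x \<bullet> (X *v x)})"
    by (auto simp: psd_cone_def)
  show "closed (psd_cone :: (real^'n^'n) set)"
    unfolding eq using lin
    by (intro closed_Int closed_INT ballI closed_subspace subspace_sym_mats closed_Collect_le
      linear_continuous_on continuous_intros) (simp add: linear_conv_bounded_linear)
  have "convex {X :: real^'n^'n. 0 \<le> x \<bullet> (X *v x)}" for x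
    using convex_linear_vimage[OF lin convex_real_interval(1)[of 0]] by (simp add: vimage_def)
  then show "convex (psd_cone :: (real^'n^'n) set)"
    unfolding eq by (intro convex_Int[OF subspace_imp_convex[OF subspace_sym_mats] convex_INT])
  show "0 \<in> (psd_cone :: (real^'n^'n) set)"
    using subspace_0[OF subspace_sym_mats] by (simp add: psd_cone_def)
qed

lemma power2_less_iff: "0 \<le> x \<Longrightarrow> 0 \<le> y \<Longrightarrow> x\<^sup>2 < y\<^sup>2 \<longleftrightarrow> x < y" for x y :: real
  by (metis power_strict_mono power2_less_imp_less zero_less_numeral)

lemma prox_F:
  fixes Y :: "real^'n^'n"
  assumes "0 < t"
  shows "prox t F Y = proj_psd Y"
  unfolding prox_def proj_psd_def
proof (rule arg_min_on_eq_closest_point)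
  show "psd_cone \<noteq> ({} :: (real^'n^'n) set)" using psd_cone_props(3) by blast
  show "psd_cone \<subseteq> (sym_mats :: (real^'n^'n) set)" by (auto simp: psd_cone_def)
qed (use assms in \<open>auto simp: psd_cone_props F_def indicator_fun_def divide_less_cancel power2_less_iff\<close>)

text \<open>The effective domain of \<open>G\<close> as \<open>prox\<close> sees it: the
  minimization there runs over symmetric matrices, and A is linear only on these.\<close>

definition feasible :: "(real^'n^'n \<Rightarrow> real^'m) \<Rightarrow> real^'m \<Rightarrow> (real^'n^'n) set" where
  "feasible A b = {X \<in> sym_mats. A X = b}"

text \<open>Surjectivity of \<open>A \<circ> As\<close> yields a feasible point in the range of the
  adjoint, and the feasible set is the translate by this point of the kernel of A on symmetric
  matrices.\<close>

lemma feasible_props: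
  assumes "sdp_data C A"
  shows "convex (feasible A b)" "closed (feasible A b)" "feasible A b \<noteq> {}"
proof -
  from assms obtain As where lin: "linear_on_sym A" and As: "adjoint_on_sym A As" "bij (A \<circ> As)"
    by (auto simp: sdp_data_def)
  obtain y where "(A \<circ> As) y = b" using As(2) by (metis bij_pointE)
  then have x0: "As y \<in> feasible A b"
    using As(1) by (simp add: feasible_def adjoint_on_sym_def)
  then show "feasible A b \<noteq> {}" by blast
  define K where "K = {X \<in> sym_mats. A X = 0}"
  have add: "A (X + Y) = A X + A Y" if "X \<in> sym_mats" "Y \<in> sym_mats" for X Y
    using lin that by (simp add: linear_on_sym_def)
  have scale: "A (r *\<^sub>R X) = r *\<^sub>R A X" if "X \<in> sym_mats" for X r
    using lin that by (simp add: linear_on_sym_def)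
  have sub: "subspace K"
    unfolding K_def using subspace_sym_mats add scale scale[of 0 0]
    by (auto simp: subspace_def)
  have eq: "feasible A b = (+) (As y) ` K"
  proof (intro equalityI subsetI)
    fix X assume X: "X \<in> feasible A b"
    have D: "X - As y \<in> sym_mats"
      using X x0 subspace_diff[OF subspace_sym_mats] by (auto simp: feasible_def)
    have "A (X - As y) = 0"
      using add[OF D, of "As y"] X x0 by (simp add: feasible_def)
    then have "X - As y \<in> K" using D by (simp add: K_def)
    then show "X \<in> (+) (As y) ` K" by (metis image_eqI add.commute diff_add_cancel)
  next
    fix X assume "X \<in> (+) (As y) ` K"
    then show "X \<in> feasible A b"
      using x0 add subspace_add[OF subspace_sym_mats] by (auto simp: feasible_def K_def)
  qed
  show "convex (feasible A b)" "closed (feasible A b)"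
    unfolding eq using sub
    by (auto intro: convex_translation subspace_imp_convex closed_translation closed_subspace)
qed

text \<open>Completing the square: the linear objective moves the centre of the quadratic term from
  Y to \<open>Y - t *\<^sub>R C\<close> and adds a constant independent of X.\<close>

lemma prox_G:
  fixes C :: "real^'n^'n"
  assumes "sdp_data C A" "0 < t"
  shows "prox t (G C A b) Y = closest_point (feasible A b) (Y - t *\<^sub>R C)"
  unfolding prox_def
proof (rule arg_min_on_eq_closest_point)
  note feasible_props[OF assms(1), of b]
  then show "convex (feasible A b)" "closed (feasible A b)" "feasible A b \<noteq> {}" by auto
  show "feasible A b \<subseteq> sym_mats" by (auto simp: feasible_def)
  fix X X' assume X: "X \<in> feasible A b"
  have sq: "C \<bullet> X + 1 / (2 * t) * (norm (X - Y))\<^sup>2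
      = 1 / (2 * t) * (norm (X - (Y - t *\<^sub>R C)))\<^sup>2 + C \<bullet> Y - t / 2 * (C \<bullet> C)" for X
    using assms(2) by (simp add: power2_norm_eq_inner inner_simps inner_commute field_simps)
  have val: "G C A b X + ereal (1 / (2 * t) * (norm (X - Y))\<^sup>2)
      = ereal (1 / (2 * t) * (norm (X - (Y - t *\<^sub>R C)))\<^sup>2 + C \<bullet> Y - t / 2 * (C \<bullet> C))"
    if "X \<in> feasible A b" for X
    using that sq[of X] by (simp add: G_def indicator_fun_def feasible_def)
  { assume X': "X' \<in> feasible A b"
    show "(G C A b X + ereal (1 / (2 * t) * (norm (X - Y))\<^sup>2)
        < G C A b X' + ereal (1 / (2 * t) * (norm (X' - Y))\<^sup>2))
      = (norm (X - (Y - t *\<^sub>R C)) < norm (X' - (Y - t *\<^sub>R C)))"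
      unfolding val[OF X] val[OF X'] using assms(2) by (simp add: divide_less_cancel power2_less_iff) }
  assume "X' \<in> sym_mats - feasible A b"
  then show "G C A b X + ereal (1 / (2 * t) * (norm (X - Y))\<^sup>2)
        < G C A b X' + ereal (1 / (2 * t) * (norm (X' - Y))\<^sup>2)"
    unfolding val[OF X] by (simp add: G_def indicator_fun_def feasible_def)
qed

section \<open>Firm nonexpansiveness of the proximal maps and of the Douglas-Rachford
  operator\<close>

lemma prox_G_firm:
  assumes "sdp_data C A" "0 < t"
  shows "(norm (prox t (G C A b) X - prox t (G C A b) Y))\<^sup>2
    \<le> (prox t (G C A b) X - prox t (G C A b) Y) \<bullet> (X - Y)"
  using closest_point_firm[OF feasible_props[OF assms(1), of b], of "X - t *\<^sub>R C" "Y - t *\<^sub>R C"]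
  by (simp add: prox_G[OF assms])

lemma prox_G_nonexpansive:
  assumes "sdp_data C A" "0 < t"
  shows "norm (prox t (G C A b) X - prox t (G C A b) Y) \<le> norm (X - Y)"
  using closest_point_lipschitz[OF feasible_props[OF assms(1), of b], of "X - t *\<^sub>R C" "Y - t *\<^sub>R C"]
  by (simp add: prox_G[OF assms] dist_norm)

lemma proj_psd_firm:
  "(norm (proj_psd X - proj_psd Y))\<^sup>2 \<le> (proj_psd X - proj_psd Y) \<bullet> (X - Y)"
  using closest_point_firm[of psd_cone] psd_cone_props unfolding proj_psd_def by blast

text \<open>The left-hand side minus the right-hand side is twice the sum of the firmness defects of
  the two proximal maps, and both defects are nonpositive.\<close>

lemma T_DRS_firm:
  assumes "sdp_data C A" "0 < t"
  shows "(norm (T_DRS C A b t X - T_DRS C A b t Y))\<^sup>2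
      + (norm ((X - T_DRS C A b t X) - (Y - T_DRS C A b t Y)))\<^sup>2 \<le> (norm (X - Y))\<^sup>2"
proof -
  define p where "p = proj_psd X - proj_psd Y"
  define g where "g = prox t (G C A b) (2 *\<^sub>R proj_psd X - X) - prox t (G C A b) (2 *\<^sub>R proj_psd Y - Y)"
  have T: "T_DRS C A b t X - T_DRS C A b t Y = g - p + (X - Y)"
    "(X - T_DRS C A b t X) - (Y - T_DRS C A b t Y) = p - g"
    using assms by (simp_all add: T_DRS_def prox_F p_def g_def)
  have "(norm g)\<^sup>2 \<le> g \<bullet> ((2 *\<^sub>R proj_psd X - X) - (2 *\<^sub>R proj_psd Y - Y))"
    unfolding g_def by (rule prox_G_firm[OF assms])
  also have "(2 *\<^sub>R proj_psd X - X) - (2 *\<^sub>R proj_psd Y - Y) = 2 *\<^sub>R p - (X - Y)"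
    by (simp add: p_def algebra_simps)
  finally have g: "(norm g)\<^sup>2 \<le> g \<bullet> (2 *\<^sub>R p - (X - Y))" .
  have p: "(norm p)\<^sup>2 \<le> p \<bullet> (X - Y)"
    unfolding p_def by (rule proj_psd_firm)
  have "(norm (g - p + D))\<^sup>2 + (norm (p - g))\<^sup>2
      = (norm D)\<^sup>2 + 2 * ((norm g)\<^sup>2 - g \<bullet> (2 *\<^sub>R p - D)) + 2 * ((norm p)\<^sup>2 - p \<bullet> D)" for D
    by (simp add: power2_norm_eq_inner inner_simps inner_commute algebra_simps)
  then show ?thesis unfolding T using g p by (smt (verit))
qed

section \<open>Chebyshev filters\<close>

lemma poly_chebyshev_cos: "poly (chebyshev d) (cos \<theta>) = cos (real d * \<theta>)"
proof (induction d rule: chebyshev.induct)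
  case (3 d)
  have "cos (real (Suc (Suc d)) * \<theta>) = 2 * cos \<theta> * cos (real (Suc d) * \<theta>) - cos (real d * \<theta>)"
    using cos_add[of "real (Suc d) * \<theta>" \<theta>] cos_diff[of "real (Suc d) * \<theta>" \<theta>]
    by (simp add: algebra_simps)
  then show ?case using 3 by (simp add: algebra_simps)
qed simp_all

lemma abs_chebyshev_le_1:
  assumes "\<bar>x\<bar> \<le> 1"
  shows "\<bar>poly (chebyshev d) x\<bar> \<le> 1"
  using poly_chebyshev_cos[of d "arccos x"] assms by (simp add: cos_arccos_abs abs_cos_le_one)

text \<open>Consecutive absolute values grow at least by the factor 1 + m: the three-term recurrence
  multiplies by 2 \<open>\<bar>x\<bar>\<close>, which is at least 2 + m, and subtracts the previous
  value, which by induction is not larger than the current one.\<close>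

lemma abs_chebyshev_ge_power:
  assumes "0 \<le> m" "1 + m \<le> \<bar>x\<bar>"
  shows "(1 + m) ^ d \<le> \<bar>poly (chebyshev d) x\<bar>"
proof -
  let ?T = "\<lambda>d. \<bar>poly (chebyshev d) x\<bar>"
  have step: "(1 + m) * ?T d \<le> ?T (Suc d)" for d
  proof (induction d)
    case 0
    then show ?case using assms by simp
  next
    case (Suc d)
    have "1 * ?T d \<le> (1 + m) * ?T d" using assms by (intro mult_right_mono) auto
    then have "?T d \<le> ?T (Suc d)" using Suc by linarith
    moreover have "2 * \<bar>x\<bar> * ?T (Suc d) - ?T d \<le> ?T (Suc (Suc d))"
      using abs_triangle_ineq2[of "2 * x * poly (chebyshev (Suc d)) x" "poly (chebyshev d) x"]
      by (simp add: abs_mult algebra_simps)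
    moreover have "(2 + m) * ?T (Suc d) \<le> 2 * \<bar>x\<bar> * ?T (Suc d)"
      using assms by (intro mult_right_mono) auto
    ultimately show ?case by (simp add: algebra_simps)
  qed
  show ?thesis
  proof (induction d)
    case (Suc d)
    have "(1 + m) * (1 + m) ^ d \<le> (1 + m) * ?T d" using Suc assms by (intro mult_left_mono) auto
    then show ?case using step[of d] by simp
  qed simp
qed

lemma abs_filter_poly_le_1:
  assumes "lo < hi" "s \<in> {lo..hi}"
  shows "\<bar>poly (filter_poly d lo hi ^ q) s\<bar> \<le> 1"
proof -
  have "\<bar>(s - (hi + lo) / 2) / ((hi - lo) / 2)\<bar> \<le> 1"
    using assms by (simp add: abs_le_iff divide_simps)
  from abs_chebyshev_le_1[OF this] show ?thesis
    by (simp add: poly_filter_poly poly_power power_abs power_le_one)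
qed

lemma abs_filter_poly_ge_power:
  assumes "lo < hi" "0 \<le> m" "m \<le> \<bar>s - (lo + hi) / 2\<bar> / ((hi - lo) / 2) - 1" "1 \<le> q"
  shows "(1 + m) ^ d \<le> \<bar>poly (filter_poly d lo hi ^ q) s\<bar>"
proof -
  let ?y = "(s - (hi + lo) / 2) / ((hi - lo) / 2)"
  have "1 + m \<le> \<bar>?y\<bar>" using assms by (simp only: abs_divide add.commute[of hi lo])
  from abs_chebyshev_ge_power[OF assms(2) this]
  have T: "(1 + m) ^ d \<le> \<bar>poly (chebyshev d) ?y\<bar>" .
  \<comment> \<open>The Chebyshev value is at least 1 in absolute value, so raising it to the power
    \<open>q\<close> does not decrease it.\<close>
  have "1 \<le> (1 + m) ^ d" using assms by (intro one_le_power) auto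
  then have "\<bar>poly (chebyshev d) ?y\<bar> ^ 1 \<le> \<bar>poly (chebyshev d) ?y\<bar> ^ q"
    using T assms(4) by (intro power_increasing) auto
  then show ?thesis using T by (simp add: poly_filter_poly poly_power power_abs)
qed

text \<open>The origin of the constant 4 and of the cap at 1: for m \<le> 1, ln (1 + m) \<ge> m / (1
  + m) \<ge> m / 2, so d ln (1 + m) is at least 2 ln x.\<close>

lemma square_le_power_of_degree:
  assumes "0 < m" "m \<le> 1" "0 < x" "4 * (ln x / m) \<le> real d"
  shows "x\<^sup>2 \<le> (1 + m) ^ d"
proof -
  have "ln (1 / (1 + m)) \<le> 1 / (1 + m) - 1"
    using assms by (intro ln_le_minus_one) auto
  then have "m / (1 + m) \<le> ln (1 + m)"
    using assms by (simp add: ln_div field_simps)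
  moreover have "m / 2 \<le> m / (1 + m)" using assms by (simp add: field_simps)
  ultimately have "m / 2 \<le> ln (1 + m)" by linarith
  then have "real d * (m / 2) \<le> real d * ln (1 + m)" by (intro mult_left_mono) auto
  moreover have "2 * ln x \<le> real d * (m / 2)" using assms by (simp add: field_simps)
  ultimately have "ln (x\<^sup>2) \<le> ln ((1 + m) ^ d)"
    using assms by (simp add: ln_realpow)
  then show ?thesis using assms by simp
qed

section \<open>Polynomials of a matrix on eigenvectors\<close>

lemma matrix_vector_mult_sum: "(\<Sum>i\<in>S. A i) *v x = (\<Sum>i\<in>S. A i *v x)"
  for A :: "'a \<Rightarrow> real^'n^'m"
  by (induction S rule: infinite_finite_induct) (simp_all add: matrix_vector_mult_add_rdistrib)

lemma poly_mat_eigenvector: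
  assumes "X *v v = \<mu> *\<^sub>R v"
  shows "poly_mat r X *v v = poly r \<mu> *\<^sub>R v"
proof -
  have "mat_pow X i *v v = \<mu> ^ i *\<^sub>R v" for i
    by (induction i) (simp_all add: assms matrix_vector_mul_assoc[symmetric] matrix_vector_mult_scaleR mult.commute)
  then show ?thesis
    by (simp add: poly_mat_def matrix_vector_mult_sum scaleR_matrix_vector_assoc[symmetric]
        poly_altdef scaleR_sum_left mult.commute)
qed

section \<open>Eigenvalue decompositions and projections\<close>

definition outer :: "real^'n \<Rightarrow> real^'n \<Rightarrow> real^'n^'n" where
  "outer u v = (\<chi> i j. u $ i * v $ j)"

lemma outer_simps:
  "outer u (v + w) = outer u v + outer u w" "outer (u + w) v = outer u v + outer w v"
  "outer u (v - w) = outer u v - outer u w" "outer (u - w) v = outer u v - outer w v"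
  "transpose (outer u v) = outer v u"
  by (simp_all add: outer_def vec_eq_iff transpose_def algebra_simps)

lemma inner_outer: "outer u v \<bullet> X = u \<bullet> (X *v v)"
  by (simp add: outer_def inner_vec_def matrix_vector_mult_def sum_distrib_left algebra_simps)

lemma outer_mult_vec: "outer u v *v x = (v \<bullet> x) *\<^sub>R u"
  by (simp add: outer_def inner_vec_def matrix_vector_mult_def vec_eq_iff sum_distrib_right sum_distrib_left algebra_simps)

lemma norm_outer: "norm (outer u v) = norm u * norm v"
proof -
  have "outer u v \<bullet> outer u v = (u \<bullet> u) * (v \<bullet> v)"
    by (simp add: inner_outer outer_mult_vec)
  then show ?thesis by (simp add: norm_eq_sqrt_inner real_sqrt_mult)
qed

lemma norm_outer_diff_le: "norm (outer u u - outer w w) \<le> (norm u + norm w) * norm (u - w)"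
proof -
  have "outer u u - outer w w = outer (u - w) u + outer w (u - w)"
    by (simp add: outer_simps)
  then show ?thesis
    using norm_triangle_ineq[of "outer (u - w) u" "outer w (u - w)"] by (simp add: norm_outer algebra_simps)
qed

lemma mult_outer: "W ** outer u v ** transpose W = outer (W *v u) (W *v v)"
proof -
  have "(W ** outer u v ** transpose W) *v x = outer (W *v u) (W *v v) *v x" for x
    by (simp add: matrix_vector_mul_assoc[symmetric] outer_mult_vec matrix_vector_mult_scaleR dot_lmul_matrix[symmetric] inner_commute)
  then show ?thesis by (simp add: matrix_eq)
qed

lemma inner_column:
  fixes V :: "real^'n^'n"
  assumes "orthogonal_matrix V"
  shows "column i V \<bullet> column j V = (if i = j then 1 else 0)"
  using assms by (auto simp: orthogonal_matrix_orthonormal_columns orthogonal_def norm_eq_1)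

lemma matrix_vector_mult_columns: "U *v c = (\<Sum>j\<in>UNIV. c $ j *\<^sub>R column j U)"
  for U :: "real^'p^'n"
  by (simp add: matrix_vector_mult_def column_def vec_eq_iff sum_component mult.commute)

lemma orthogonal_expansion:
  fixes V :: "real^'n^'n"
  assumes "orthogonal_matrix V"
  shows "x = (\<Sum>i\<in>UNIV. (column i V \<bullet> x) *\<^sub>R column i V)"
proof -
  have "x = V *v (transpose V *v x)"
    using assms by (simp add: matrix_vector_mul_assoc orthogonal_matrix_def del: transpose_matrix_vector)
  also have "\<dots> = (\<Sum>i\<in>UNIV. (transpose V *v x) $ i *\<^sub>R column i V)"
    by (rule matrix_vector_mult_columns)
  also have "\<dots> = (\<Sum>i\<in>UNIV. (column i V \<bullet> x) *\<^sub>R column i V)"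
    by (intro sum.cong refl arg_cong2[of _ _ _ _ scaleR])
      (simp add: matrix_vector_mult_def column_def transpose_def inner_vec_def del: transpose_matrix_vector)
  finally show ?thesis .
qed

lemma norm_sum_columns:
  fixes V :: "real^'n^'n"
  assumes "orthogonal_matrix V"
  shows "(norm (\<Sum>i\<in>S. f i *\<^sub>R column i V))\<^sup>2 = (\<Sum>i\<in>S. (f i)\<^sup>2)"
proof -
  have "f i * (\<Sum>j\<in>S. f j * (if j = i then 1 else 0)) = (f i)\<^sup>2" if "i \<in> S" for i
    using that by (simp add: if_distrib[of "\<lambda>x. _ * x"] power2_eq_square cong: if_cong)
  then show ?thesis
    unfolding power2_norm_eq_inner inner_sum_left inner_sum_right inner_scaleR_left inner_scaleR_right
      inner_column[OF assms]
    by simp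
qed

lemma eigen_decomp_outer:
  assumes "eigen_decomp Z V lam"
  shows "Z = (\<Sum>i\<in>UNIV. lam $ i *\<^sub>R outer (column i V) (column i V))"
proof -
  have V: "orthogonal_matrix V" and e: "\<And>i. Z *v column i V = lam $ i *\<^sub>R column i V"
    using assms by (auto simp: eigen_decomp_def)
  have "Z *v x = (\<Sum>i\<in>UNIV. lam $ i *\<^sub>R outer (column i V) (column i V)) *v x" for x
  proof -
    have "Z *v x = Z *v (\<Sum>i\<in>UNIV. (column i V \<bullet> x) *\<^sub>R column i V)"
      using orthogonal_expansion[OF V, of x] by simp
    also have "\<dots> = (\<Sum>i\<in>UNIV. (column i V \<bullet> x) *\<^sub>R lam $ i *\<^sub>R column i V)"
      by (simp add: linear_sum[OF matrix_vector_mul_linear[of Z]] matrix_vector_mult_scaleR e)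
    also have "\<dots> = (\<Sum>i\<in>UNIV. lam $ i *\<^sub>R outer (column i V) (column i V)) *v x"
      by (simp add: matrix_vector_mult_sum scaleR_matrix_vector_assoc[symmetric] outer_mult_vec mult.commute)
    finally show ?thesis .
  qed
  then show ?thesis by (simp add: matrix_eq)
qed

text \<open>An eigenvalue is the inner product of Z with a rank-one matrix of Frobenius norm 1, so
  Cauchy-Schwarz applies.\<close>

lemma abs_eigenvalue_le_norm:
  assumes "eigen_decomp Z V lam"
  shows "\<bar>lam $ i\<bar> \<le> norm Z"
proof -
  have V: "orthogonal_matrix V" and e: "Z *v column i V = lam $ i *\<^sub>R column i V"
    using assms by (auto simp: eigen_decomp_def)
  have n: "norm (column i V) = 1" using inner_column[OF V, of i i] by (simp add: norm_eq_1)
  have "lam $ i = outer (column i V) (column i V) \<bullet> Z"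
    by (simp add: inner_outer e inner_column[OF V])
  then show ?thesis
    using Cauchy_Schwarz_ineq2[of "outer (column i V) (column i V)" Z] by (simp add: norm_outer n)
qed

text \<open>W is symmetric and idempotent, hence an orthogonal projection. The two norm bounds are
  its contraction and best-approximation properties, both from Pythagoras.\<close>

lemma orthonormal_cols_projection:
  fixes U :: "real^'p^'n"
  assumes "orthonormal_cols U"
  defines "W \<equiv> U ** transpose U"
  shows "transpose W = W" "W ** W = W"
    and "x \<in> span (columns U) \<Longrightarrow> W *v x = x"
    and "norm (W *v x) \<le> norm x"
    and "y \<in> span (columns U) \<Longrightarrow> norm (W *v x - x) \<le> norm (x - y)"
proof -
  have I: "transpose U ** U = mat 1" using assms by (simp add: orthonormal_cols_def)
  show s: "transpose W = W" by (simp add: W_def matrix_transpose_mul)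
  have "W ** W = U ** (transpose U ** U) ** transpose U"
    unfolding W_def by (simp only: matrix_mul_assoc)
  then show idem: "W ** W = W" by (simp add: I W_def)
  have inn: "(W *v x) \<bullet> y = x \<bullet> (W *v y)" for x y
    by (metis dot_lmul_matrix s transpose_matrix_vector)
  have idem': "W *v (W *v x) = W *v x" for x
    by (simp add: matrix_vector_mul_assoc idem)
  have pyth: "(norm x)\<^sup>2 = (norm (W *v x))\<^sup>2 + (norm (x - W *v x))\<^sup>2" for x
    by (simp add: power2_norm_eq_inner inner_simps inn idem' inner_commute)
  show fixW: "W *v x = x" if "x \<in> span (columns U)" for x
  proof -
    have "W *v (U *v c) = U *v c" for c
      by (simp add: matrix_vector_mul_assoc W_def matrix_mul_assoc[symmetric] I)
    from this[of "axis j 1" for j] have "column j U \<in> {x. W *v x = x}" for j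
      by (simp add: matrix_vector_mult_basis)
    then have "span (columns U) \<subseteq> {x. W *v x = x}"
      by (intro span_minimal) (auto simp: columns_def subspace_def matrix_vector_right_distrib matrix_vector_mult_scaleR)
    then show ?thesis using that by auto
  qed
  show "norm (W *v x) \<le> norm x" for x
    by (rule power2_le_imp_le) (use pyth[of x] in auto)
  show "norm (W *v x - x) \<le> norm (x - y)" if "y \<in> span (columns U)"
  proof -
    \<comment> \<open>Since W fixes y, the residuals of x and of x - y agree up to sign.\<close>
    have "norm (W *v x - x) = norm ((x - y) - W *v (x - y))"
      using fixW[OF that] by (simp add: matrix_vector_mult_diff_distrib norm_minus_commute)
    also have "\<dots> \<le> norm (x - y)"
      by (rule power2_le_imp_le) (use pyth[of "x - y"] in auto)
    finally show ?thesis .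
  qed
qed

section \<open>Errors of the compressed semidefinite projection and of one subspace
  iteration\<close>

lemma inner_psd_nonneg: "P \<in> psd_cone \<Longrightarrow> 0 \<le> x \<bullet> (P *v x)"
  by (simp add: psd_cone_def)

lemma sum_outer_in_psd_cone:
  fixes v :: "'i \<Rightarrow> real^'n"
  assumes "\<And>i. i \<in> I \<Longrightarrow> 0 \<le> a i"
  shows "(\<Sum>i\<in>I. a i *\<^sub>R outer (v i) (v i)) \<in> psd_cone"
proof -
  let ?S = "\<Sum>i\<in>I. a i *\<^sub>R outer (v i) (v i)"
  have "?S \<in> sym_mats"
    by (intro subspace_sum[OF subspace_sym_mats] subspace_scale[OF subspace_sym_mats])
      (simp add: sym_mats_def outer_simps)
  moreover have "0 \<le> x \<bullet> (?S *v x)" for x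
    using assms
    by (simp add: matrix_vector_mult_sum inner_sum_right scaleR_matrix_vector_assoc[symmetric]
        outer_mult_vec inner_commute mult.assoc sum_nonneg)
  ultimately show ?thesis by (simp add: psd_cone_def)
qed

text \<open>
  Let D be the difference of the two matrices. By the variational inequality of the projection, the
  squared norm of D is at most its inner product with the positive part of Z minus W Z W. There the
  positive eigenvalues contribute O(\<open>\<delta>\<close>) times the norm of D, and the others O(\<open>\<delta>\<close>^2).
\<close>

lemma filtered_projection_error:
  fixes Z :: "real^'n^'n"
  assumes eig: "eigen_decomp Z V lam"
    and W: "transpose W = W" "\<And>x. norm (W *v x) \<le> norm x"
    and close: "\<And>i. 0 < lam $ i \<Longrightarrow> norm (W *v column i V - column i V) \<le> \<delta>"
    and \<delta>: "0 \<le> \<delta>" and M: "norm Z \<le> M"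
  shows "norm (proj_psd (W ** Z ** W) - (\<Sum>i | 0 < lam $ i. lam $ i *\<^sub>R outer (column i V) (column i V)))
    \<le> 3 * real CARD('n) * M * \<delta>"
proof -
  let ?v = "\<lambda>i. column i V"
  define I where "I = {i. 0 < lam $ i}"
  define P where "P = proj_psd (W ** Z ** W)"
  define Zp where "Zp = (\<Sum>i\<in>I. lam $ i *\<^sub>R outer (?v i) (?v i))"
  define D where "D = Zp - P"
  define n where "n = real CARD('n)"
  have V: "orthogonal_matrix V" using eig by (simp add: eigen_decomp_def)
  note inner_column[OF V, simp]
  have nv: "norm (?v i) = 1" for i by (simp add: norm_eq_1)
  have lam: "\<bar>lam $ i\<bar> \<le> M" for i
    using abs_eigenvalue_le_norm[OF eig, of i] M by linarith
  have M0: "0 \<le> M" using M norm_ge_zero order_trans by blast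
  have Winn: "(W *v x) \<bullet> y = x \<bullet> (W *v y)" for x y
    by (metis dot_lmul_matrix W(1) transpose_matrix_vector)
  have P: "P \<in> psd_cone"
    unfolding P_def proj_psd_def using psd_cone_props by (intro closest_point_in_set) auto
  have Zp: "Zp \<in> psd_cone"
    unfolding Zp_def by (rule sum_outer_in_psd_cone) (simp add: I_def)
  have "D \<bullet> D = (Zp - W ** Z ** W) \<bullet> D + (W ** Z ** W - P) \<bullet> D"
    by (simp add: D_def inner_diff_left)
  moreover have "(W ** Z ** W - P) \<bullet> D \<le> 0"
    unfolding D_def P_def proj_psd_def using psd_cone_props Zp by (intro closest_point_dot) auto
  moreover have "W ** Z ** W = (\<Sum>i\<in>UNIV. lam $ i *\<^sub>R outer (W *v ?v i) (W *v ?v i))"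
  proof -
    have lin: "linear (\<lambda>X. W ** X ** W)"
      by (rule linearI) (simp_all add: matrix_eq matrix_vector_mul_assoc[symmetric] matrix_vector_mult_add_rdistrib
        matrix_vector_right_distrib scaleR_matrix_vector_assoc[symmetric] matrix_vector_mult_scaleR)
    have "W ** Z ** W = W ** (\<Sum>i\<in>UNIV. lam $ i *\<^sub>R outer (?v i) (?v i)) ** W"
      using eigen_decomp_outer[OF eig] by simp
    also have "\<dots> = (\<Sum>i\<in>UNIV. lam $ i *\<^sub>R (W ** outer (?v i) (?v i) ** W))"
      by (simp add: linear_sum[OF lin] linear_cmul[OF lin])
    finally show ?thesis using mult_outer[of W] by (simp add: W(1))
  qed
  moreover have "\<dots> = (\<Sum>i\<in>I. lam $ i *\<^sub>R outer (W *v ?v i) (W *v ?v i))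
      + (\<Sum>i\<in>-I. lam $ i *\<^sub>R outer (W *v ?v i) (W *v ?v i))"
    by (subst sum.union_disjoint[symmetric]) (auto intro: sum.cong)
  ultimately have main: "D \<bullet> D \<le> (\<Sum>i\<in>I. lam $ i *\<^sub>R (outer (?v i) (?v i) - outer (W *v ?v i) (W *v ?v i))) \<bullet> D
      + (\<Sum>j\<in>-I. - lam $ j *\<^sub>R outer (W *v ?v j) (W *v ?v j)) \<bullet> D"
    by (simp add: Zp_def scaleR_diff_right sum_subtractf inner_simps sum_negf)
  have cardI: "real (card S) \<le> n" for S :: "'n set"
    by (simp add: n_def card_mono)
  have "norm (\<Sum>i\<in>I. lam $ i *\<^sub>R (outer (?v i) (?v i) - outer (W *v ?v i) (W *v ?v i))) \<le> (\<Sum>i\<in>I. M * (2 * \<delta>))"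
  proof (intro sum_norm_le)
    fix i assume "i \<in> I"
    then have c: "norm (?v i - W *v ?v i) \<le> \<delta>"
      using close[of i] by (simp add: I_def norm_minus_commute)
    have "norm (outer (?v i) (?v i) - outer (W *v ?v i) (W *v ?v i)) \<le> (norm (?v i) + norm (W *v ?v i)) * norm (?v i - W *v ?v i)"
      by (rule norm_outer_diff_le)
    also have "\<dots> \<le> 2 * \<delta>"
      using W(2)[of "?v i"] c by (intro mult_mono) (auto simp: nv)
    finally show "norm (lam $ i *\<^sub>R (outer (?v i) (?v i) - outer (W *v ?v i) (W *v ?v i))) \<le> M * (2 * \<delta>)"
      using lam[of i] M0 by (simp add: mult_mono)
  qed
  also have "\<dots> \<le> n * (M * (2 * \<delta>))"
    using cardI[of I] M0 \<delta> by (simp add: mult_right_mono)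
  finally have first: "(\<Sum>i\<in>I. lam $ i *\<^sub>R (outer (?v i) (?v i) - outer (W *v ?v i) (W *v ?v i))) \<bullet> D
      \<le> 2 * n * M * \<delta> * norm D"
    by (intro order_trans[OF norm_cauchy_schwarz] mult_right_mono) (auto simp: algebra_simps)
  have "(\<Sum>j\<in>-I. - lam $ j *\<^sub>R outer (W *v ?v j) (W *v ?v j)) \<bullet> D
      = (\<Sum>j\<in>-I. - lam $ j * ((W *v ?v j) \<bullet> (D *v (W *v ?v j))))"
    by (simp add: inner_sum_left inner_outer)
  also have "\<dots> \<le> (\<Sum>j\<in>-I. M * (n * (M * \<delta>\<^sup>2)))"
  proof (intro sum_mono)
    fix j assume j: "j \<in> - I"
    \<comment> \<open>Subtracting the semidefinite P can only lower the quadratic form, so D may be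
      replaced by \<open>Zp\<close>.\<close>
    have "(W *v ?v j) \<bullet> (D *v (W *v ?v j)) \<le> (W *v ?v j) \<bullet> (Zp *v (W *v ?v j))"
      using inner_psd_nonneg[OF P] by (simp add: D_def matrix_vector_mult_diff_rdistrib inner_diff_right)
    also have "\<dots> = (\<Sum>i\<in>I. lam $ i * (?v i \<bullet> (W *v ?v j))\<^sup>2)"
      by (simp add: Zp_def matrix_vector_mult_sum inner_sum_right scaleR_matrix_vector_assoc[symmetric]
        outer_mult_vec inner_commute power2_eq_square mult.assoc)
    also have "\<dots> \<le> (\<Sum>i\<in>I. M * \<delta>\<^sup>2)"
    proof (intro sum_mono mult_mono)
      fix i assume i: "i \<in> I"
      then have "i \<noteq> j" using j by auto
      \<comment> \<open>Orthogonality of the two eigenvectors allows \<open>?v i\<close> to be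
        subtracted, so each factor is O(\<delta>) and its square O(\<delta>^2).\<close>
      then have "?v i \<bullet> (W *v ?v j) = (W *v ?v i - ?v i) \<bullet> ?v j"
        by (simp add: inner_diff_left Winn)
      then have "\<bar>?v i \<bullet> (W *v ?v j)\<bar> \<le> norm (W *v ?v i - ?v i)"
        using Cauchy_Schwarz_ineq2[of "W *v ?v i - ?v i" "?v j"] by (simp add: nv)
      also have "\<dots> \<le> \<delta>" using close i by (simp add: I_def)
      finally show "(?v i \<bullet> (W *v ?v j))\<^sup>2 \<le> \<delta>\<^sup>2"
        using abs_le_square_iff[of "?v i \<bullet> (W *v ?v j)" \<delta>] \<delta> by simp
      show "lam $ i \<le> M" using lam[of i] by linarith
    qed (use M0 in auto)
    also have "\<dots> \<le> n * (M * \<delta>\<^sup>2)"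
      using cardI[of I] M0 by (simp add: mult_right_mono)
    finally have le: "(W *v ?v j) \<bullet> (D *v (W *v ?v j)) \<le> n * (M * \<delta>\<^sup>2)" .
    show "- lam $ j * ((W *v ?v j) \<bullet> (D *v (W *v ?v j))) \<le> M * (n * (M * \<delta>\<^sup>2))"
    proof -
      have "0 \<le> - lam $ j" using j by (simp add: I_def)
      then have "- lam $ j * ((W *v ?v j) \<bullet> (D *v (W *v ?v j))) \<le> - lam $ j * (n * (M * \<delta>\<^sup>2))"
        using le by (intro mult_left_mono)
      also have "\<dots> \<le> M * (n * (M * \<delta>\<^sup>2))"
        using lam[of j] M0 by (intro mult_right_mono) (auto simp: n_def)
      finally show ?thesis .
    qed
  qed
  also have "\<dots> \<le> n * (M * (n * (M * \<delta>\<^sup>2)))"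
    using cardI[of "-I"] M0 by (simp add: n_def mult_right_mono)
  also have "\<dots> = (n * M * \<delta>)\<^sup>2" by (simp add: power2_eq_square)
  finally have "D \<bullet> D \<le> 2 * (n * M * \<delta>) * norm D + (n * M * \<delta>)\<^sup>2"
    using main first by (simp add: mult.assoc)
  then have sq: "norm D * norm D \<le> 2 * (n * M * \<delta>) * norm D + (n * M * \<delta>)\<^sup>2"
    by (simp add: power2_norm_eq_inner[symmetric] power2_eq_square)
  \<comment> \<open>The quadratic inequality allows at most (1 + sqrt 2) times n M \<delta>; 3 is
    this factor rounded up.\<close>
  have "norm D \<le> 3 * (n * M * \<delta>)"
  proof (rule ccontr)
    define e where "e = n * M * \<delta>"
    assume "\<not> ?thesis"
    then have D: "3 * e < norm D" by (simp add: e_def)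
    have e: "0 \<le> e" using M0 \<delta> by (simp add: e_def n_def)
    have "e * e \<le> norm D * e" using D e by (intro mult_right_mono) auto
    moreover have "norm D * (3 * e) < norm D * norm D" using D e by (intro mult_strict_left_mono) auto
    moreover have "norm D * norm D \<le> 2 * e * norm D + e * e" using sq by (simp add: e_def power2_eq_square)
    ultimately show False by (simp add: algebra_simps)
  qed
  then show ?thesis
    unfolding D_def Zp_def P_def I_def n_def by (simp add: norm_minus_commute mult.assoc)
qed

text \<open>The preceding estimate with W the identity, where \<delta> = 0 is admissible and the
  error vanishes.\<close>

lemma proj_psd_eigen_decomp:
  fixes Z :: "real^'n^'n"
  assumes "eigen_decomp Z V lam"
  shows "proj_psd Z = (\<Sum>i | 0 < lam $ i. lam $ i *\<^sub>R outer (column i V) (column i V))"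
proof -
  have "norm (proj_psd (mat 1 ** Z ** mat 1) - (\<Sum>i | 0 < lam $ i. lam $ i *\<^sub>R outer (column i V) (column i V)))
    \<le> 3 * real CARD('n) * norm Z * 0"
    by (rule filtered_projection_error[OF assms]) (simp_all add: transpose_mat)
  then show ?thesis by simp
qed

text \<open>Among the wanted eigenvectors, \<open>U *v c\<close> has a component only along the
  i-th, namely 1. The filter scales that component by at least g in absolute value and the unwanted
  ones by at most 1, so after rescaling the image lies within the stated distance of the
  eigenvector. It belongs to the new column space, whose best approximation is at least as
  close.\<close>

lemma subspace_iteration_error:
  fixes Z :: "real^'n^'n" and U U' :: "real^'p^'n"
  assumes eig: "eigen_decomp Z V lam"
    and orth: "is_orth (poly_mat r Z ** U) U'"
    and dual: "\<And>j. j \<in> I \<Longrightarrow> column j V \<bullet> (U *v c) = (if j = i then 1 else 0)"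
    and damp: "\<And>j. j \<notin> I \<Longrightarrow> \<bar>poly r (lam $ j)\<bar> \<le> 1"
    and i: "i \<in> I" and g: "0 < g" "g \<le> \<bar>poly r (lam $ i)\<bar>"
  shows "norm (U' ** transpose U' *v column i V - column i V) \<le> norm (U *v c) / g"
proof -
  let ?v = "\<lambda>i. column i V"
  define x where "x = U *v c"
  define \<rho> where "\<rho> j = poly r (lam $ j)" for j
  have V: "orthogonal_matrix V" and e: "\<And>i. Z *v ?v i = lam $ i *\<^sub>R ?v i"
    using eig by (auto simp: eigen_decomp_def)
  \<comment> \<open>The filtered vector, rescaled to have component 1 along the i-th eigenvector; it
    is the competitor in the best-approximation bound.\<close>
  define y where "y = (1 / \<rho> i) *\<^sub>R (poly_mat r Z *v x)"
  have \<rho>i: "g \<le> \<bar>\<rho> i\<bar>" using g by (simp add: \<rho>_def)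
  have "poly_mat r Z *v x = (poly_mat r Z ** U) *v c"
    by (simp add: x_def matrix_vector_mul_assoc)
  then have "y \<in> span (columns (poly_mat r Z ** U))"
    unfolding y_def by (intro span_scale) (simp add: matrix_vector_mult_in_columnspace)
  then have y: "y \<in> span (columns U')" using orth by (auto simp: is_orth_def)
  have xj: "?v j \<bullet> x = (if j = i then 1 else 0)" if "j \<in> I" for j
    using dual[OF that] by (simp add: x_def)
  have "poly_mat r Z *v x = poly_mat r Z *v (\<Sum>j\<in>UNIV. (?v j \<bullet> x) *\<^sub>R ?v j)"
    using orthogonal_expansion[OF V, of x] by simp
  also have "\<dots> = (\<Sum>j\<in>UNIV. ((?v j \<bullet> x) * \<rho> j) *\<^sub>R ?v j)"
    by (simp add: linear_sum[OF matrix_vector_mul_linear[of "poly_mat r Z"]] matrix_vector_mult_scaleR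
        poly_mat_eigenvector[OF e] \<rho>_def)
  \<comment> \<open>The components along wanted eigenvectors other than the i-th vanish by
    \<open>dual\<close>, so only the i-th and the damped ones remain.\<close>
  also have "\<dots> = (\<Sum>j\<in>UNIV. (if j = i then \<rho> i *\<^sub>R ?v i else 0)
      + (if j \<in> I then 0 else ((?v j \<bullet> x) * \<rho> j) *\<^sub>R ?v j))"
    using i by (intro sum.cong) (auto simp: xj)
  also have "\<dots> = \<rho> i *\<^sub>R ?v i + (\<Sum>j\<in>UNIV. (if j \<in> I then 0 else (?v j \<bullet> x) * \<rho> j) *\<^sub>R ?v j)"
    by (simp add: sum.distrib if_distrib[of "\<lambda>a. a *\<^sub>R _"] cong: if_cong)
  finally have pz: "poly_mat r Z *v x - \<rho> i *\<^sub>R ?v i = (\<Sum>j\<in>UNIV. (if j \<in> I then 0 else (?v j \<bullet> x) * \<rho> j) *\<^sub>R ?v j)"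
    by simp
  have "(norm (poly_mat r Z *v x - \<rho> i *\<^sub>R ?v i))\<^sup>2 = (\<Sum>j\<in>UNIV. (if j \<in> I then 0 else (?v j \<bullet> x) * \<rho> j)\<^sup>2)"
    unfolding pz by (rule norm_sum_columns[OF V])
  also have "\<dots> \<le> (\<Sum>j\<in>UNIV. (?v j \<bullet> x)\<^sup>2)"
  proof (intro sum_mono)
    fix j
    show "(if j \<in> I then 0 else (?v j \<bullet> x) * \<rho> j)\<^sup>2 \<le> (?v j \<bullet> x)\<^sup>2"
    proof (cases "j \<in> I")
      case False
      then have "\<bar>?v j \<bullet> x\<bar> * \<bar>\<rho> j\<bar> \<le> \<bar>?v j \<bullet> x\<bar> * 1"
        using damp by (intro mult_left_mono) (auto simp: \<rho>_def)
      then show ?thesis using False by (simp add: abs_le_square_iff[symmetric] abs_mult)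
    qed simp
  qed
  also have "\<dots> = (norm x)\<^sup>2"
    using norm_sum_columns[OF V, of "\<lambda>j. ?v j \<bullet> x" UNIV] orthogonal_expansion[OF V, of x] by simp
  finally have num: "norm (poly_mat r Z *v x - \<rho> i *\<^sub>R ?v i) \<le> norm x"
    by (rule power2_le_imp_le) simp
  have "?v i - y = - (1 / \<rho> i) *\<^sub>R (poly_mat r Z *v x - \<rho> i *\<^sub>R ?v i)"
    using g \<rho>i by (simp add: y_def algebra_simps)
  then have "norm (?v i - y) = norm (poly_mat r Z *v x - \<rho> i *\<^sub>R ?v i) / \<bar>\<rho> i\<bar>"
    by (simp add: abs_divide)
  also have "\<dots> \<le> norm x / g"
    using num \<rho>i g by (intro frac_le) auto
  finally have "norm (?v i - y) \<le> norm x / g" .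
  moreover have "norm (U' ** transpose U' *v ?v i - ?v i) \<le> norm (?v i - y)"
    using orthonormal_cols_projection(5)[OF _ y] orth by (simp add: is_orth_def)
  ultimately show ?thesis by (simp add: x_def)
qed

section \<open>Principal angles\<close>

text \<open>The matrix is diagonal because sin 0 = 0, and applying it to the l-th unit vector
  isolates its l-th entry.\<close>

lemma abs_sin_arccos_le_spectral_norm:
  assumes "l < n"
  shows "\<bar>sin (arccos (sv ! l))\<bar> \<le> spectral_norm {..<n} {..<n} (\<lambda>l m. sin (angle_matrix sv l m))"
proof -
  let ?S = "\<lambda>l. sin (arccos (sv ! l))"
  let ?f = "\<lambda>x. L2_set (\<lambda>l. \<Sum>m<n. sin (angle_matrix sv l m) * x m) {..<n}"
  have f: "?f x = L2_set (\<lambda>l. ?S l * x l) {..<n}" for x :: "nat \<Rightarrow> real"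
  proof (intro L2_set_cong refl)
    fix l assume "l \<in> {..<n}"
    then show "(\<Sum>m<n. sin (angle_matrix sv l m) * x m) = ?S l * x l"
      by (simp add: angle_matrix_def if_distrib[of sin] if_distrib[of "\<lambda>a. a * _"] cong: if_cong)
  qed
  \<comment> \<open>This bounds the set under the supremum, without which no element could be
    compared with it.\<close>
  have le: "?f x \<le> 1" if "L2_set x {..<n} \<le> 1" for x :: "nat \<Rightarrow> real"
  proof -
    have "?f x \<le> L2_set x {..<n}"
      unfolding f unfolding L2_set_def
    proof (intro real_sqrt_le_mono sum_mono)
      fix l
      show "(?S l * x l)\<^sup>2 \<le> (x l)\<^sup>2"
        using abs_sin_le_one[of "arccos (sv ! l)"] mult_left_le_one_le[of "\<bar>x l\<bar>" "\<bar>?S l\<bar>"]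
        by (simp add: abs_le_square_iff[symmetric] abs_mult)
    qed
    then show ?thesis using that by linarith
  qed
  let ?e = "\<lambda>m. if m = l then 1 else 0 :: real"
  have "L2_set ?e {..<n} = 1"
    using assms by (simp add: L2_set_def if_distrib[of "\<lambda>a. a\<^sup>2"] cong: if_cong)
  then have "?f ?e \<le> spectral_norm {..<n} {..<n} (\<lambda>l m. sin (angle_matrix sv l m))"
    unfolding spectral_norm_def using le by (intro cSUP_upper bdd_aboveI[of _ 1]) auto
  moreover have "?f ?e = \<bar>?S l\<bar>"
    unfolding f using assms
    by (simp add: L2_set_def power_mult_distrib if_distrib[of "\<lambda>a. a\<^sup>2"] if_distrib[of "\<lambda>a. _ * a"] cong: if_cong)
  ultimately show ?thesis by simp
qed

text \<open>
  The squared distances of the unit vectors from the span of the u l are nonnegative and add up to 0.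
\<close>

lemma orthonormal_square_transpose:
  fixes u :: "nat \<Rightarrow> 'i \<Rightarrow> real"
  assumes I: "finite I"
    and on: "\<And>l m. l < card I \<Longrightarrow> m < card I \<Longrightarrow> (\<Sum>i\<in>I. u l i * u m i) = (if l = m then 1 else 0)"
    and i: "i \<in> I" "j \<in> I"
  shows "(\<Sum>l<card I. u l i * u l j) = (if i = j then 1 else 0)"
proof -
  define s where "s = card I"
  \<comment> \<open>Row i is the residual of the i-th unit vector after projection onto the span of
    the \<open>u l\<close>.\<close>
  define r where "r i j = (if i = j then 1 else 0) - (\<Sum>l<s. u l i * u l j)" for i j
  have r2: "(\<Sum>j\<in>I. (r i j)\<^sup>2) = 1 - (\<Sum>l<s. (u l i)\<^sup>2)" if "i \<in> I" for i
  proof -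
    have "(\<Sum>j\<in>I. (r i j)\<^sup>2) = (\<Sum>j\<in>I. (if i = j then 1 else 0) - 2 * (if i = j then (\<Sum>l<s. u l i * u l j) else 0)
        + (\<Sum>l<s. u l i * u l j)\<^sup>2)"
      by (intro sum.cong) (auto simp: r_def power2_diff)
    also have "\<dots> = 1 - 2 * (\<Sum>l<s. u l i * u l i) + (\<Sum>j\<in>I. (\<Sum>l<s. u l i * u l j)\<^sup>2)"
      using I that by (simp add: sum.distrib sum_subtractf sum_distrib_left[symmetric])
    also have "(\<Sum>j\<in>I. (\<Sum>l<s. u l i * u l j)\<^sup>2) = (\<Sum>j\<in>I. \<Sum>l<s. \<Sum>m<s. u l i * u m i * (u l j * u m j))"
      by (simp add: power2_eq_square sum_product algebra_simps)
    also have "\<dots> = (\<Sum>l<s. \<Sum>m<s. u l i * u m i * (\<Sum>j\<in>I. u l j * u m j))"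
    proof -
      have "(\<Sum>j\<in>I. \<Sum>l<s. \<Sum>m<s. u l i * u m i * (u l j * u m j)) = (\<Sum>l<s. \<Sum>j\<in>I. \<Sum>m<s. u l i * u m i * (u l j * u m j))"
        by (rule sum.swap)
      also have "\<dots> = (\<Sum>l<s. \<Sum>m<s. \<Sum>j\<in>I. u l i * u m i * (u l j * u m j))"
        by (intro sum.cong refl sum.swap)
      finally show ?thesis by (simp only: sum_distrib_left)
    qed
    also have "\<dots> = (\<Sum>l<s. \<Sum>m<s. u l i * u m i * (if l = m then 1 else 0))"
      by (intro sum.cong) (auto simp: on s_def)
    also have "\<dots> = (\<Sum>l<s. u l i * u l i)"
      by (simp add: if_distrib[of "\<lambda>a. _ * a"] cong: if_cong)
    finally show ?thesis by (simp add: power2_eq_square)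
  qed
  \<comment> \<open>Summing over i and exchanging the sums counts the unit vectors minus the vectors
    \<open>u l\<close>, of which there are equally many.\<close>
  have "(\<Sum>i\<in>I. \<Sum>j\<in>I. (r i j)\<^sup>2) = (\<Sum>i\<in>I. 1 - (\<Sum>l<s. (u l i)\<^sup>2))"
    by (intro sum.cong r2 refl)
  also have "\<dots> = real s - (\<Sum>l<s. \<Sum>i\<in>I. u l i * u l i)"
    using sum.swap[of "\<lambda>i l. u l i * u l i" "{..<s}" I] by (simp add: sum_subtractf s_def power2_eq_square)
  also have "\<dots> = 0" by (simp add: on s_def)
  finally have "\<forall>i\<in>I. (\<Sum>j\<in>I. (r i j)\<^sup>2) = 0"
    using I by (subst (asm) sum_nonneg_eq_0_iff) (auto intro: sum_nonneg)
  then have "\<forall>j\<in>I. (r i j)\<^sup>2 = 0"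
    using I i by (subst (asm) sum_nonneg_eq_0_iff) auto
  then show ?thesis using i by (simp add: r_def s_def)
qed

lemma norm_orthonormal_cols_mult:
  fixes U :: "real^'p^'n"
  assumes "orthonormal_cols U"
  shows "norm (U *v c) = norm c"
proof -
  have "(U *v c) \<bullet> (U *v c) = c \<bullet> ((transpose U ** U) *v c)"
    by (simp only: matrix_vector_mul_assoc[symmetric] transpose_matrix_vector) (metis dot_lmul_matrix inner_commute)
  then show ?thesis using assms by (simp add: orthonormal_cols_def norm_eq_sqrt_inner)
qed

text \<open>The vector c is the pseudoinverse of the matrix of inner products between selected
  eigenvectors and columns of U, applied to the i-th unit vector. Its norm is controlled since all
  singular values, the cosines of the principal angles, are at least sqrt (1 - \<gamma>^2).\<close>

lemma sin_Theta_less_dual_vectors: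
  fixes U :: "real^'p^'n"
  assumes V: "orthogonal_matrix V" and U: "orthonormal_cols U"
    and card: "card I \<le> CARD('p)"
    and sin: "sin_Theta_less I V U \<gamma>" and \<gamma>: "\<gamma> < 1" and i: "i \<in> I"
  obtains c where "\<And>j. j \<in> I \<Longrightarrow> column j V \<bullet> (U *v c) = (if j = i then 1 else 0)"
    and "norm (U *v c) \<le> 1 / sqrt (1 - \<gamma>\<^sup>2)" and "0 < \<gamma>"
proof -
  let ?M = "\<lambda>i j. column i V \<bullet> column j U"
  obtain sv where sv: "is_singular_values I UNIV ?M sv"
    and sp: "spectral_norm {..<length sv} {..<length sv} (\<lambda>l m. sin (angle_matrix sv l m)) < \<gamma>"
    using sin by (auto simp: sin_Theta_less_def)
  define s where "s = card I"
  \<comment> \<open>By \<open>card\<close> there are as many singular values as selected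
    eigenvectors, so every selected direction is controlled by an angle.\<close>
  have len: "length sv = s" and pos: "\<And>l. l < s \<Longrightarrow> 0 \<le> sv ! l"
    using sv card by (auto simp: is_singular_values_def s_def)
  from sv[unfolded is_singular_values_def len]
  obtain u w where uw: "\<forall>l<s. \<forall>m<s. (\<Sum>i\<in>I. u l i * u m i) = (if l = m then 1 else 0) \<and>
      (\<Sum>j\<in>UNIV. w l j * w m j) = (if l = m then 1 else 0)"
    and M: "\<forall>i\<in>I. \<forall>j\<in>UNIV. ?M i j = (\<Sum>l<s. sv ! l * u l i * w l j)"
    by blast
  have u: "(\<Sum>i\<in>I. u l i * u m i) = (if l = m then 1 else 0)"
    and w: "(\<Sum>j\<in>UNIV. w l j * w m j) = (if l = m then 1 else 0)" if "l < s" "m < s" for l m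
    using uw that by blast+
  define wv :: "nat \<Rightarrow> real^'p" where "wv l = (\<chi> j. w l j)" for l
  have wv: "wv l \<bullet> wv m = (if l = m then 1 else 0)" if "l < s" "m < s" for l m
    using w[OF that] by (simp add: wv_def inner_vec_def)
  have nwv: "norm (wv l) = 1" if "l < s" for l
    using wv[OF that that] by (simp add: norm_eq_1)
  have vw: "column i V \<bullet> (U *v wv m) = sv ! m * u m i" if "i \<in> I" "m < s" for i m
  proof -
    have "column i V \<bullet> (U *v wv m) = (\<Sum>j\<in>UNIV. w m j * ?M i j)"
      by (simp add: matrix_vector_mult_columns inner_sum_right wv_def)
    also have "\<dots> = (\<Sum>j\<in>UNIV. \<Sum>l<s. sv ! l * u l i * (w l j * w m j))"
      by (simp add: M that(1) sum_distrib_left algebra_simps)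
    also have "\<dots> = (\<Sum>l<s. sv ! l * u l i * (\<Sum>j\<in>UNIV. w l j * w m j))"
      by (subst sum.swap) (simp add: sum_distrib_left)
    also have "\<dots> = (\<Sum>l<s. sv ! l * u l i * (if l = m then 1 else 0))"
      using that by (intro sum.cong refl) (simp add: w)
    also have "\<dots> = sv ! m * u m i"
      using that by (simp add: if_distrib[of "\<lambda>a. _ * a"] cong: if_cong)
    finally show ?thesis .
  qed
  \<comment> \<open>A singular value is the inner product of two unit vectors, hence at most 1, and
    only then is it the cosine of its \<open>arccos\<close>.\<close>
  have sv1: "sv ! m \<le> 1" if m: "m < s" for m
  proof -
    define uv where "uv = (\<Sum>i\<in>I. u m i *\<^sub>R column i V)"
    have "(norm uv)\<^sup>2 = (\<Sum>i\<in>I. u m i * u m i)"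
      unfolding uv_def norm_sum_columns[OF V] by (simp add: power2_eq_square)
    then have "norm uv = 1" using u[OF m m] norm_ge_zero[of uv] by (auto simp: power2_eq_1_iff)
    moreover have "uv \<bullet> (U *v wv m) = (\<Sum>i\<in>I. sv ! m * (u m i * u m i))"
      by (simp add: uv_def inner_sum_left vw m algebra_simps)
    then have "uv \<bullet> (U *v wv m) = sv ! m"
      using u[OF m m] by (simp add: sum_distrib_left[symmetric])
    ultimately show ?thesis
      using norm_cauchy_schwarz[of uv "U *v wv m"] by (simp add: norm_orthonormal_cols_mult[OF U] nwv m)
  qed
  have "0 < s" using i by (auto simp: s_def card_gt_0_iff)
  have sin_le: "\<bar>sin (arccos (sv ! l))\<bar> < \<gamma>" if "l < s" for l
    using abs_sin_arccos_le_spectral_norm[of l "length sv" sv] sp len that by simp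
  \<comment> \<open>As i lies in I there is at least one angle; positivity of \<gamma> turns
    \<gamma> < 1 into \<gamma>^2 < 1.\<close>
  then have \<gamma>0: "0 < \<gamma>" using \<open>0 < s\<close> abs_ge_zero order_le_less_trans by blast
  then have g: "0 < 1 - \<gamma>\<^sup>2" using \<gamma> by (simp add: power_less_one_iff)
  have sv2: "1 - \<gamma>\<^sup>2 \<le> (sv ! l)\<^sup>2" "0 < sv ! l" if "l < s" for l
  proof -
    have "(sin (arccos (sv ! l)))\<^sup>2 \<le> \<gamma>\<^sup>2"
      using sin_le[OF that] \<gamma>0 by (simp add: abs_le_square_iff[symmetric])
    moreover have "(sin (arccos (sv ! l)))\<^sup>2 + (sv ! l)\<^sup>2 = 1"
      using sin_cos_squared_add[of "arccos (sv ! l)"] pos[OF that] sv1[OF that] by simp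
    ultimately show "1 - \<gamma>\<^sup>2 \<le> (sv ! l)\<^sup>2" by linarith
    then show "0 < sv ! l" using g pos[OF that] by (cases "sv ! l = 0") auto
  qed
  define c where "c = (\<Sum>l<s. (u l i / sv ! l) *\<^sub>R wv l)"
  \<comment> \<open>The left singular vectors form a square orthogonal matrix, so its columns are
    orthonormal as well as its rows.\<close>
  have trans: "(\<Sum>l<s. u l j * u l i) = (if j = i then 1 else 0)" if "j \<in> I" for j
    using orthonormal_square_transpose[of I u j i] u i that by (simp add: s_def)
  show thesis
  proof (rule that[of c])
    show "column j V \<bullet> (U *v c) = (if j = i then 1 else 0)" if "j \<in> I" for j
    proof -
      have "column j V \<bullet> (U *v c) = (\<Sum>l<s. (u l i / sv ! l) * (column j V \<bullet> (U *v wv l)))"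
        by (simp add: c_def linear_sum[OF matrix_vector_mul_linear[of U]] matrix_vector_mult_scaleR inner_sum_right)
      also have "\<dots> = (\<Sum>l<s. u l j * u l i)"
        using sv2(2) by (intro sum.cong refl) (fastforce simp: vw that)
      finally show ?thesis using trans[OF that] by simp
    qed
    have "(norm c)\<^sup>2 = (\<Sum>l<s. \<Sum>m<s. (u l i / sv ! l) * ((u m i / sv ! m) * (wv m \<bullet> wv l)))"
      unfolding power2_norm_eq_inner c_def inner_sum_left inner_sum_right inner_scaleR_left inner_scaleR_right
        sum_distrib_left by (rule refl)
    also have "\<dots> = (\<Sum>l<s. \<Sum>m<s. (u l i / sv ! l) * ((u m i / sv ! m) * (if m = l then 1 else 0)))"
      by (intro sum.cong refl) (simp add: wv)
    also have "\<dots> = (\<Sum>l<s. (u l i)\<^sup>2 / (sv ! l)\<^sup>2)"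
      by (simp add: if_distrib[of "\<lambda>a. _ * a"] power2_eq_square cong: if_cong)
    also have "\<dots> \<le> (\<Sum>l<s. (u l i)\<^sup>2 / (1 - \<gamma>\<^sup>2))"
      using sv2 g by (intro sum_mono frac_le) auto
    also have "\<dots> = 1 / (1 - \<gamma>\<^sup>2)"
      using trans[OF i] by (simp add: sum_divide_distrib[symmetric] power2_eq_square)
    finally have "norm c \<le> sqrt (1 / (1 - \<gamma>\<^sup>2))" by (rule real_le_rsqrt)
    then show "norm (U *v c) \<le> 1 / sqrt (1 - \<gamma>\<^sup>2)"
      by (simp add: norm_orthonormal_cols_mult[OF U] real_sqrt_divide)
    show "0 < \<gamma>" by (rule \<gamma>0)
  qed
qed

section \<open>Convergence of the filtered iteration\<close>

text \<open>Passing from k to k + 1 costs a factor 4, since k + 1 \<le> 2 k for k \<ge> 1; S absorbs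
  the finitely many values before N.\<close>

lemma eventually_bound_Suc_square:
  fixes E :: "nat \<Rightarrow> real"
  assumes ev: "\<And>k. N \<le> k \<Longrightarrow> E k \<le> A / (real k)\<^sup>2" and "1 \<le> N" "0 \<le> A" "\<And>k. 0 \<le> E k"
  obtains B where "\<And>k. E k \<le> B / (real (Suc k))\<^sup>2"
proof
  define S where "S = (\<Sum>j<N. E j * (real (Suc j))\<^sup>2)"
  have S: "0 \<le> S" unfolding S_def using assms by (intro sum_nonneg) auto
  fix k
  show "E k \<le> (4 * A + S) / (real (Suc k))\<^sup>2"
  proof (cases "N \<le> k")
    case True
    have "(real (Suc k))\<^sup>2 \<le> (2 * real k)\<^sup>2"
      using True assms(2) by (intro power_mono) auto
    then have "A * (real (Suc k))\<^sup>2 \<le> A * (4 * (real k)\<^sup>2)"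
      using assms(3) by (intro mult_left_mono) (auto simp: power_mult_distrib)
    then have "A / (real k)\<^sup>2 \<le> 4 * A / (real (Suc k))\<^sup>2"
      using True assms(2) by (simp add: divide_simps algebra_simps del: of_nat_Suc)
    also have "\<dots> \<le> (4 * A + S) / (real (Suc k))\<^sup>2"
      using S by (intro divide_right_mono) auto
    finally show ?thesis using ev[OF True] by linarith
  next
    case False
    then have "E k * (real (Suc k))\<^sup>2 \<le> S"
      unfolding S_def using assms(4) by (intro member_le_sum) auto
    then have "E k * (real (Suc k))\<^sup>2 \<le> 4 * A + S" using assms(3) by linarith
    then show ?thesis by (simp add: pos_le_divide_eq del: of_nat_Suc)
  qed
qed

lemma pfam_orthonormal_cols:
  assumes "pfam C A b t lo hi d q Z U"
  shows "orthonormal_cols (U k)"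
  using assms by (cases k) (auto simp: pfam_def is_orth_def)

text \<open>The indices fit together: \<open>U (Suc k)\<close> arises from \<open>U k\<close> by the
  filter of \<open>Z (Suc k)\<close>, and the angle condition compares the eigenvectors of this same
  matrix with \<open>U k\<close>.\<close>

lemma pfam_projection_error:
  fixes U :: "nat \<Rightarrow> real^'p^'n" and Z :: "nat \<Rightarrow> real^'n^'n"
  assumes pfam: "pfam C A b t lo hi d q Z U"
    and spec: "filter_spectrum lo hi Z U V lam"
    and P: "assumption_P lo hi Z U V lam \<gamma> M l"
  shows "norm (proj_psd (proj_sub (U (Suc k)) (Z (Suc k))) - proj_psd (Z (Suc k)))
    \<le> 3 * real CARD('n) * M * (max 0 (1 / sqrt (1 - \<gamma>\<^sup>2)) / (1 + min l 1) ^ d (Suc k))"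
proof -
  \<comment> \<open>The \<open>max 0\<close> makes the bound nonnegative whatever the sign of 1 -
    \<gamma>^2; \<gamma> > 0 is derived only from the presence of a positive eigenvalue.\<close>
  define K where "K = max 0 (1 / sqrt (1 - \<gamma>\<^sup>2))"
  define k' where "k' = Suc k"
  define m where "m = min l 1"
  define g where "g = (1 + m) ^ d k'"
  define W where "W = U k' ** transpose (U k')"
  define I where "I = outside (lam k') (lo k') (hi k')"
  define r where "r = filter_poly (d k') (lo k') (hi k') ^ q k'"
  have eig: "eigen_decomp (Z k') (V k') (lam k')"
    and I: "I = {i. 0 < lam k' $ i}" and card: "card I \<le> CARD('p)"
    using spec unfolding filter_spectrum_def I_def by blast+
  have \<gamma>: "\<gamma> < 1" and sin: "sin_Theta_less I (V k') (U k) \<gamma>" and M: "norm (Z k') \<le> M"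
    and l: "0 < l" and gap: "ereal l \<le> rel_gap (lam k') (lo k') (hi k')"
    using P by (auto simp: assumption_P_def I_def k'_def)
  have lohi: "lo k' < hi k'" "1 \<le> q k'" and orth: "is_orth (poly_mat r (Z k') ** U k) (U k')"
    using pfam by (auto simp: pfam_def r_def k'_def)
  have m: "0 < m" using l by (simp add: m_def)
  then have g: "0 < g" by (simp add: g_def)
  note W = orthonormal_cols_projection[OF pfam_orthonormal_cols[OF pfam, of k'], folded W_def]
  have "norm (proj_psd (W ** Z k' ** W)
      - (\<Sum>i | 0 < lam k' $ i. lam k' $ i *\<^sub>R outer (column i (V k')) (column i (V k'))))
    \<le> 3 * real CARD('n) * M * (K / g)"
  proof (rule filtered_projection_error[OF eig W(1,4) _ _ M])
    fix i assume "0 < lam k' $ i"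
    then have i: "i \<in> I" by (simp add: I)
    have V: "orthogonal_matrix (V k')" using eig by (simp add: eigen_decomp_def)
    obtain c where c: "\<And>j. j \<in> I \<Longrightarrow> column j (V k') \<bullet> (U k *v c) = (if j = i then 1 else 0)"
      "norm (U k *v c) \<le> 1 / sqrt (1 - \<gamma>\<^sup>2)"
      using sin_Theta_less_dual_vectors[OF V pfam_orthonormal_cols[OF pfam] card sin \<gamma> i] by metis
    have "norm (W *v column i (V k') - column i (V k')) \<le> norm (U k *v c) / g"
      unfolding W_def
    proof (rule subspace_iteration_error[OF eig orth c(1) _ i g])
      fix j assume "j \<notin> I"
      then show "\<bar>poly r (lam k' $ j)\<bar> \<le> 1"
        unfolding r_def using lohi(1) by (intro abs_filter_poly_le_1) (auto simp: I_def outside_def)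
    next
      have "ereal l \<le> ereal (\<bar>lam k' $ i - (lo k' + hi k') / 2\<bar> / ((hi k' - lo k') / 2) - 1)"
        using gap i unfolding rel_gap_def I_def by (meson INF_lower order_trans)
      then have "m \<le> \<bar>lam k' $ i - (lo k' + hi k') / 2\<bar> / ((hi k' - lo k') / 2) - 1"
        unfolding ereal_less_eq m_def by linarith
      then show "g \<le> \<bar>poly r (lam k' $ i)\<bar>"
        unfolding g_def r_def using m lohi by (intro abs_filter_poly_ge_power) auto
    qed
    also have "\<dots> \<le> K / g"
      using c(2) g by (intro divide_right_mono) (auto simp: K_def)
    finally show "norm (W *v column i (V k') - column i (V k')) \<le> K / g" .
  next
    show "0 \<le> K / g" using g by (simp add: K_def)
  qed
  moreover have "proj_sub (U k') (Z k') = W ** Z k' ** W"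
    by (simp add: proj_sub_def W_def matrix_mul_assoc)
  ultimately show ?thesis
    by (simp only: proj_psd_eigen_decomp[OF eig] k'_def[symmetric] K_def[symmetric] m_def[symmetric] g_def[symmetric])
qed

text \<open>The two steps differ only in the semidefinite projection. Its error enters the
  nonexpansive proximal map of \<open>G\<close> doubled and the subtracted term once, hence the
  factor 3.\<close>

lemma pfam_step_error:
  fixes U :: "nat \<Rightarrow> real^'p^'n" and Z :: "nat \<Rightarrow> real^'n^'n"
  assumes sdp: "sdp_data C A" "0 < t" and pfam: "pfam C A b t lo hi d q Z U"
  shows "norm (Z (Suc k) - T_DRS C A b t (Z k)) \<le> 3 * norm (proj_psd (proj_sub (U k) (Z k)) - proj_psd (Z k))"
proof -
  let ?P = "proj_psd (proj_sub (U k) (Z k))" and ?Q = "proj_psd (Z k)" and ?R = "prox t (G C A b)"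
  have "Z (Suc k) - T_DRS C A b t (Z k)
      = (?R (2 *\<^sub>R ?P - Z k) - ?R (2 *\<^sub>R ?Q - Z k)) - (?P - ?Q)"
    using pfam sdp by (simp add: pfam_def T_DRS_def prox_F Let_def)
  then have "norm (Z (Suc k) - T_DRS C A b t (Z k))
      \<le> norm (?R (2 *\<^sub>R ?P - Z k) - ?R (2 *\<^sub>R ?Q - Z k)) + norm (?P - ?Q)"
    using norm_triangle_ineq4 by metis
  moreover have "norm (?R (2 *\<^sub>R ?P - Z k) - ?R (2 *\<^sub>R ?Q - Z k)) \<le> norm (2 *\<^sub>R (?P - ?Q))"
    using prox_G_nonexpansive[OF sdp, of b "2 *\<^sub>R ?P - Z k" "2 *\<^sub>R ?Q - Z k"]
    by (simp add: scaleR_diff_right)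
  ultimately show ?thesis by simp
qed

theorem theorem3p8:
  shows "\<exists>c>0. \<forall>(C :: real^'n^'n) (A :: real^'n^'n \<Rightarrow> real^'m) b t lo hi (d :: nat \<Rightarrow> nat) q
            (Z :: nat \<Rightarrow> real^'n^'n) (U :: nat \<Rightarrow> real^'p^'n) V lam \<gamma> M l.
     sdp_data C A \<longrightarrow> 0 < t \<longrightarrow>
     pfam C A b t lo hi d q Z U \<longrightarrow>
     filter_spectrum lo hi Z U V lam \<longrightarrow>
     assumption_P lo hi Z U V lam \<gamma> M l \<longrightarrow>
     (\<forall>\<^sub>F k in sequentially. real (d k) \<ge> c * (ln (real k) / min l 1)) \<longrightarrow>
     (\<lambda>k. norm (Z k - T_DRS C A b t (Z k))) \<in> O(\<lambda>k. 1 / sqrt (real k))"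
\<comment> \<open>The constant is that of \<open>square_le_power_of_degree\<close>.\<close>
proof (intro exI[of _ 4] conjI allI impI)
  fix C :: "real^'n^'n" and A :: "real^'n^'n \<Rightarrow> real^'m" and b t lo hi
    and d :: "nat \<Rightarrow> nat" and q and Z :: "nat \<Rightarrow> real^'n^'n" and U :: "nat \<Rightarrow> real^'p^'n"
    and V lam \<gamma> M l
  assume sdp: "sdp_data C A" "0 < t" and pfam: "pfam C A b t lo hi d q Z U"
    and spec: "filter_spectrum lo hi Z U V lam"
    and P: "assumption_P lo hi Z U V lam \<gamma> M l"
    and deg: "\<forall>\<^sub>F k in sequentially. real (d k) \<ge> 4 * (ln (real k) / min l 1)"
  define K where "K = max 0 (1 / sqrt (1 - \<gamma>\<^sup>2))"
  define m where "m = min l 1"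
  \<comment> \<open>The 9 combines the factor 3 of the step error with the factor 3 of the
    projection error.\<close>
  define B where "B = 9 * real CARD('n) * M * K"
  have bnd: "\<And>k. norm (Z k) \<le> M" and m: "0 < m" "m \<le> 1"
    using P by (auto simp: assumption_P_def m_def)
  have "0 \<le> M" using order_trans[OF norm_ge_zero bnd[of 0]] .
  then have B: "0 \<le> B" by (simp add: B_def K_def)
  obtain N where N: "\<And>k. N \<le> k \<Longrightarrow> real (d k) \<ge> 4 * (ln (real k) / m)"
    using deg unfolding eventually_sequentially m_def by auto
  \<comment> \<open>The projection error is available only for k \<ge> 1, because the angle
    condition pairs each basis \<open>U j\<close> with the next iterate; the degree bound holds from
    N on.\<close>
  have "norm (Z (Suc k) - T_DRS C A b t (Z k)) \<le> B / (real k)\<^sup>2" if k1: "max 1 N \<le> k" for k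
  proof -
    obtain j where k: "k = Suc j" using k1 by (cases k) auto
    have "norm (Z (Suc k) - T_DRS C A b t (Z k)) \<le> 3 * (3 * real CARD('n) * M * (K / (1 + m) ^ d k))"
      using pfam_step_error[OF sdp pfam, of k] pfam_projection_error[OF pfam spec P, of j]
      unfolding k K_def m_def by linarith
    also have "\<dots> = B / (1 + m) ^ d k" by (simp add: B_def)
    also have "\<dots> \<le> B / (real k)\<^sup>2"
      using square_le_power_of_degree[OF m, of "real k" "d k"] N[of k] k1 B by (intro divide_left_mono) (auto simp: m add_pos_pos)
    finally show ?thesis .
  qed
  then obtain B' where "\<And>k. norm (Z (Suc k) - T_DRS C A b t (Z k)) \<le> B' / (real (Suc k))\<^sup>2"
    using eventually_bound_Suc_square[of "max 1 N" "\<lambda>k. norm (Z (Suc k) - T_DRS C A b t (Z k))" B] B by auto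
  then show "(\<lambda>k. norm (Z k - T_DRS C A b t (Z k))) \<in> O(\<lambda>k. 1 / sqrt (real k))"
    by (intro inexact_firm_rate[OF T_DRS_firm[OF sdp] bnd])
qed simp

end
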